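(* Let $\{G_n\}_{n\in\mathbb N}$ be a dense graph sequence and let $W_n$ be the graphon associated to $G_n$. Assume $W\in\mathcal W_0$ satisfies $\|W_n-W\|_\square\to0$. Define, on the set of Young measures $\mathcal Y([0,1],\mathbb R)$, $$I_n(\nu)=\begin{cases}\int_{[0,1]^2}W_n(x,y)\Big(\int_{\mathbb R^2}f(\lambda,\mu)\,d\nu_x(\lambda)\,d\nu_y(\mu)\Big)dx\,dy & \nu\in\mathcal X_n,\\ +\infty&\text{otherwise,}\end{cases}$$ $$I(\nu)=\begin{cases}\int_{[0,1]^2}W(x,y)\Big(\int_{\mathbb R^2}f(\lambda,\mu)\,d\nu_x(\lambda)\,d\nu_y(\mu)\Big)dx\,dy & \nu\in\mathcal X,\\ +\infty&\text{otherwise.}\end{cases}$$ Then $I_n$ $\Gamma$-converges to $I$ with respect to narrow convergence. That is, for every Young measure $\nu$: (i) for every sequence $\nu^n\to\nu$ narrowly, $I(\nu)\le\liminf_n I_n(\nu^n)$; (ii) there exists a sequence $\nu^n\to\nu$ narrowly with $\limsup_n I_n(\nu^n)=I(\nu)$.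
   Context: A dense graph sequence is a sequence of simple undirected graphs $G_n$ with vertex set $\{1,\dots,n\}$ and $\limsup_n n^2/|E(G_n)|<\infty$. Let $A^n$ be the adjacency matrix of $G_n$. Set $I_1^n=[0,1/n]$ and $I_i^n=((i-1)/n,i/n]$ for $i=2,\dots,n$. The graphon associated to $G_n$ is $W_n(x,y)=A^n_{ij}$ for $(x,y)\in I_i^n\times I_j^n$. A graphon is a bounded measurable symmetric function $W:[0,1]^2\to\mathbb R$. $\mathcal W_0$ denotes the set of graphons with values in $[0,1]$. The cut norm is $\|W\|_\square=\sup_{S,T\subseteq[0,1]}\big|\int_{S\times T}W\big|$, with the supremum over measurable sets. Fix a finite label set $\mathcal L=\{\ell_1,\dots,\ell_N\}\subset\mathbb R$ and a function $f:\mathcal L\times\mathcal L\to\mathbb R$. $X_n$ is the set of measurable $u:[0,1]\to\mathcal L$ that are constant on each $I_i^n$. A Young measure on $[0,1]$ is a family $\{\nu_x\}_{x\in[0,1]}$ of Borel probability measures on $\mathbb R$ such that $x\mapsto\int g\,d\nu_x$ is measurable for every bounded continuous $g$. $\mathcal Y([0,1],\mathbb R)$ denotes the set of all Young measures on $[0,1]$. $\mathcal X$ is the set of Young measures with $\nu_x$ supported in $\mathcal L$ for a.e. $x$, equivalently $\nu_x=\sum_k\theta_k(x)\delta_{\ell_k}$ with measurable $\theta_k\ge0$ and $\sum_k\theta_k=1$. $\mathcal X_n=\{\nu:\nu_x=\delta_{u(x)}\text{ for all }x,\ u\in X_n\}$. A sequence $\nu^n$ converges narrowly to $\nu$ if $\int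 g\,d\nu^n_x\overset{*}{\rightharpoonup}\int g\,d\nu_x$ in $L^\infty([0,1])$ for every bounded continuous $g:\mathbb R\to\mathbb R$. *)

theory Defs
  imports "HOL-Probability.Probability"
begin

definition simple_graph_seq :: "(nat \<Rightarrow> nat \<Rightarrow> nat \<Rightarrow> bool) \<Rightarrow> bool" where
  "simple_graph_seq A \<longleftrightarrow>
     (\<forall>n i j. A n i j \<longrightarrow> i \<in> {1..n} \<and> j \<in> {1..n}) \<and>
     (\<forall>n i j. A n i j = A n j i) \<and>
     (\<forall>n i. \<not> A n i i)"

definition num_edges :: "(nat \<Rightarrow> nat \<Rightarrow> nat \<Rightarrow> bool) \<Rightarrow> nat \<Rightarrow> nat" where
  "num_edges A n = card {(i, j). i \<in> {1..n} \<and> j \<in> {1..n} \<and> i < j \<and> A n i j}"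

definition dense_graph_seq :: "(nat \<Rightarrow> nat \<Rightarrow> nat \<Rightarrow> bool) \<Rightarrow> bool" where
  "dense_graph_seq A \<longleftrightarrow> simple_graph_seq A \<and>
     limsup (\<lambda>n. ereal (real (n ^ 2)) / ereal (real (num_edges A n))) < \<infinity>"

definition cellset :: "nat \<Rightarrow> nat \<Rightarrow> real set" where
  "cellset n i = (if i = 1 then {0..1 / real n} else {(real i - 1) / real n <.. real i / real n})"

definition graphon_of :: "(nat \<Rightarrow> nat \<Rightarrow> nat \<Rightarrow> bool) \<Rightarrow> nat \<Rightarrow> real \<Rightarrow> real \<Rightarrow> real" where
  "graphon_of A n x y =
     (if \<exists>i j. i \<in> {1..n} \<and> j \<in> {1..n} \<and> x \<in> cellset n i \<and> y \<in> cellset n j \<and> A n i j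
      then 1 else 0)"

abbreviation unit_sq :: "(real \<times> real) set" where
  "unit_sq \<equiv> {0..1} \<times> {0..1}"

definition graphon0 :: "(real \<Rightarrow> real \<Rightarrow> real) \<Rightarrow> bool" where
  "graphon0 W \<longleftrightarrow>
     (\<lambda>p. W (fst p) (snd p)) \<in> borel_measurable (lebesgue_on unit_sq) \<and>
     (\<forall>x\<in>{0..1}. \<forall>y\<in>{0..1}. W x y = W y x) \<and>
     (\<forall>x\<in>{0..1}. \<forall>y\<in>{0..1}. 0 \<le> W x y \<and> W x y \<le> 1)"

definition cut_norm :: "(real \<Rightarrow> real \<Rightarrow> real) \<Rightarrow> real" where
  "cut_norm U = Sup {\<bar>LINT p | lebesgue_on unit_sq. indicator (S \<times> T) p * U (fst p) (snd p)\<bar> | S T.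
       S \<in> sets (lebesgue_on {0..1}) \<and> T \<in> sets (lebesgue_on {0..1})}"

definition young_measure :: "(real \<Rightarrow> real measure) \<Rightarrow> bool" where
  "young_measure \<nu> \<longleftrightarrow>
     (\<forall>x\<in>{0..1}. prob_space (\<nu> x) \<and> sets (\<nu> x) = sets borel) \<and>
     (\<forall>g :: real \<Rightarrow> real. continuous_on UNIV g \<and> bounded (range g) \<longrightarrow>
        (\<lambda>x. LINT t | \<nu> x. g t) \<in> borel_measurable (lebesgue_on {0..1}))"

text \<open>Narrow convergence: weak-* convergence in L^infinity (dual of L^1) of x |-> int g d nu_x.\<close>
definition narrow_conv :: "(nat \<Rightarrow> real \<Rightarrow> real measure) \<Rightarrow> (real \<Rightarrow> real measure) \<Rightarrow> bool" where
  "narrow_conv \<nu>s \<nu> \<longleftrightarrow>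
     (\<forall>g :: real \<Rightarrow> real. continuous_on UNIV g \<and> bounded (range g) \<longrightarrow>
       (\<forall>\<phi> :: real \<Rightarrow> real. integrable (lebesgue_on {0..1}) \<phi> \<longrightarrow>
          (\<lambda>n. LINT x | lebesgue_on {0..1}. \<phi> x * (LINT t | \<nu>s n x. g t))
            \<longlonglongrightarrow> (LINT x | lebesgue_on {0..1}. \<phi> x * (LINT t | \<nu> x. g t))))"

definition label_class :: "real set \<Rightarrow> (real \<Rightarrow> real measure) \<Rightarrow> bool" where
  "label_class L \<nu> \<longleftrightarrow> (AE x in lebesgue_on {0..1}. emeasure (\<nu> x) (UNIV - L) = 0)"

definition label_class_n :: "real set \<Rightarrow> nat \<Rightarrow> (real \<Rightarrow> real measure) \<Rightarrow> bool" where
  "label_class_n L n \<nu> \<longleftrightarrow>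
     (\<exists>u :: real \<Rightarrow> real. u \<in> borel_measurable (lebesgue_on {0..1}) \<and>
        (\<forall>x\<in>{0..1}. u x \<in> L) \<and>
        (\<forall>i\<in>{1..n}. \<forall>x\<in>cellset n i. \<forall>y\<in>cellset n i. u x = u y) \<and>
        (\<forall>x\<in>{0..1}. \<nu> x = return borel (u x)))"

text \<open>f is only given on L x L; it is extended by 0 outside (irrelevant for measures supported in L).\<close>
definition fL :: "real set \<Rightarrow> (real \<Rightarrow> real \<Rightarrow> real) \<Rightarrow> real \<Rightarrow> real \<Rightarrow> real" where
  "fL L f a b = (if a \<in> L \<and> b \<in> L then f a b else 0)"

definition energy :: "real set \<Rightarrow> (real \<Rightarrow> real \<Rightarrow> real) \<Rightarrow> (real \<Rightarrow> real \<Rightarrow> real)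
                       \<Rightarrow> (real \<Rightarrow> real measure) \<Rightarrow> real" where
  "energy L f W \<nu> = (LINT p | lebesgue_on unit_sq.
      W (fst p) (snd p) * (LINT a | \<nu> (fst p). LINT b | \<nu> (snd p). fL L f a b))"

definition I_n :: "real set \<Rightarrow> (real \<Rightarrow> real \<Rightarrow> real) \<Rightarrow> (nat \<Rightarrow> nat \<Rightarrow> nat \<Rightarrow> bool) \<Rightarrow> nat
                   \<Rightarrow> (real \<Rightarrow> real measure) \<Rightarrow> ereal" where
  "I_n L f A n \<nu> = (if label_class_n L n \<nu> then ereal (energy L f (graphon_of A n) \<nu>) else \<infinity>)"

definition I_lim :: "real set \<Rightarrow> (real \<Rightarrow> real \<Rightarrow> real) \<Rightarrow> (real \<Rightarrow> real \<Rightarrow> real)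
                   \<Rightarrow> (real \<Rightarrow> real measure) \<Rightarrow> ereal" where
  "I_lim L f W \<nu> = (if label_class L \<nu> then ereal (energy L f W \<nu>) else \<infinity>)"

end

theory Submission
  imports Defs
begin

text \<open>A Young measure supported in \<open>L\<close> is described by its masses \<open>\<theta>\<^sub>k(x) = \<nu>\<^sub>x{k}\<close>, and its energy is
  \<open>\<Sum>\<^sub>k\<^sub>l f k l \<integral> W(x,y) \<theta>\<^sub>k(x) \<theta>\<^sub>l(y)\<close>. For \<open>\<nu>\<^sub>x = \<delta>\<^bsub>u(x)\<^esub>\<close> the masses are indicator functions, so replacing
  \<open>W\<^sub>n\<close> by \<open>W\<close> costs at most \<open>\<Sum>\<bar>f k l\<bar>\<close> times the cut norm of \<open>W\<^sub>n - W\<close>. With \<open>W\<close> fixed the energy is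
  narrowly continuous: the inner integrals \<open>\<integral> W(x,y) \<theta>\<^sup>n\<^sub>l(y) dy\<close> converge pointwise in \<open>x\<close>, hence in \<open>L\<^sup>1\<close>, and
  can be paired with the weakly converging \<open>\<theta>\<^sup>n\<^sub>k\<close>. A test function vanishing exactly on \<open>L\<close> shows that
  narrow limits of labellings are supported in \<open>L\<close>. A recovery sequence labels the \<open>n\<close> cells from left to
  right, always with the label that is furthest behind its prescribed share; the cumulative error then
  stays below the number of labels, that is, of order \<open>1/n\<close> after rescaling.\<close>

section \<open>Integration on the unit interval and the unit square\<close>

abbreviation unit_leb :: "real measure" where
  "unit_leb \<equiv> lebesgue_on {0..1}"

abbreviation square_leb :: "(real \<times> real) measure" where
  "square_leb \<equiv> lebesgue_on unit_sq"

lemma prob_space_unit_leb: "prob_space unit_leb"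
  by (rule prob_spaceI) (simp add: emeasure_restrict_space)

interpretation unit_leb: prob_space unit_leb
  by (rule prob_space_unit_leb)

lemma unit_sq_lebesgue [measurable]: "unit_sq \<in> sets lebesgue"
  by (simp add: closed_Times)

lemma finite_measure_square_leb: "finite_measure square_leb"
  by (intro finite_measure_lebesgue_on lmeasurable_compact compact_Times) auto

interpretation square_leb: finite_measure square_leb
  by (rule finite_measure_square_leb)

text \<open>Between completed measures a continuous map need not be measurable: preimages of null
  sets must be null as well. For a projection they are strips \<open>N \<times> UNIV\<close>, which
  are null by the product formula for \<open>lborel\<close>.\<close>

lemma measurable_fst_lebesgue:
  "fst \<in> (lebesgue :: ('a::euclidean_space \<times> 'b::euclidean_space) measure) \<rightarrow>\<^sub>M lebesgue"
proof -
  have m: "fst \<in> (lebesgue :: ('a \<times> 'b) measure) \<rightarrow>\<^sub>M (lborel :: 'a measure)"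
    by (rule measurable_completion) (simp add: borel_prod[symmetric])
  show ?thesis
  proof (rule complete_measure.measurable_completion2[OF completion.complete_measure_axioms m], rule subsetI)
    fix N assume N: "N \<in> null_sets (lborel :: 'a measure)"
    have [measurable]: "N \<in> sets borel" using N by auto
    have eq: "fst -` N = N \<times> (UNIV :: 'b set)" by auto
    have "emeasure (lborel :: ('a \<times> 'b) measure) (N \<times> UNIV) = 0"
      using N by (subst lborel_prod[symmetric], subst lborel.emeasure_pair_measure_Times) auto
    moreover have "N \<times> (UNIV :: 'b set) \<in> sets borel"
      by (subst borel_prod[symmetric]) auto
    ultimately show "N \<in> null_sets (distr (lebesgue :: ('a \<times> 'b) measure) lborel fst)"
      using m N by (auto simp: null_sets_def emeasure_distr eq)
  qed
qed

lemma measurable_snd_lebesgue: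
  "snd \<in> (lebesgue :: ('a::euclidean_space \<times> 'b::euclidean_space) measure) \<rightarrow>\<^sub>M lebesgue"
proof -
  have m: "snd \<in> (lebesgue :: ('a \<times> 'b) measure) \<rightarrow>\<^sub>M (lborel :: 'b measure)"
    by (rule measurable_completion) (simp add: borel_prod[symmetric])
  show ?thesis
  proof (rule complete_measure.measurable_completion2[OF completion.complete_measure_axioms m], rule subsetI)
    fix N assume N: "N \<in> null_sets (lborel :: 'b measure)"
    have [measurable]: "N \<in> sets borel" using N by auto
    have eq: "snd -` N = (UNIV :: 'a set) \<times> N" by auto
    have "emeasure (lborel :: ('a \<times> 'b) measure) (UNIV \<times> N) = 0"
      using N by (subst lborel_prod[symmetric], subst lborel.emeasure_pair_measure_Times) auto
    moreover have "(UNIV :: 'a set) \<times> N \<in> sets borel"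
      by (subst borel_prod[symmetric]) auto
    ultimately show "N \<in> null_sets (distr (lebesgue :: ('a \<times> 'b) measure) lborel snd)"
      using m N by (auto simp: null_sets_def emeasure_distr eq)
  qed
qed

lemma measurable_fst_square: "fst \<in> square_leb \<rightarrow>\<^sub>M unit_leb"
  by (rule measurable_restrict_space2)
     (auto intro: measurable_restrict_space1 measurable_fst_lebesgue simp: space_restrict_space)

lemma measurable_snd_square: "snd \<in> square_leb \<rightarrow>\<^sub>M unit_leb"
  by (rule measurable_restrict_space2)
     (auto intro: measurable_restrict_space1 measurable_snd_lebesgue simp: space_restrict_space)

text \<open>Prepares Fubini: Lebesgue measure on a product is the completion of the product measure,
  not the product of the completions, so functions extended by zero are exchanged for Borel
  functions, for which the iterated integral over \<open>lborel\<close> is available.\<close>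

lemma borel_version_lebesgue_on:
  fixes a :: "'a::euclidean_space \<Rightarrow> real"
  assumes "S \<in> sets lebesgue" "a \<in> borel_measurable (lebesgue_on S)"
  obtains a' where "a' \<in> borel_measurable borel" "AE x in lebesgue. indicator S x * a x = a' x"
proof -
  have "(\<lambda>x. indicator S x * a x) \<in> borel_measurable lebesgue"
    using assms by (subst (asm) borel_measurable_restrict_space_iff) auto
  from completion_ex_borel_measurable_real[OF this] show ?thesis
    using that by (auto dest: AE_completion)
qed

lemma AE_lebesgue_fst:
  assumes "AE x in lebesgue. P x"
  shows "AE p in (lebesgue :: ('a::euclidean_space \<times> 'b::euclidean_space) measure). P (fst p)"
proof -
  obtain N where N: "N \<in> null_sets lborel" "{x. \<not> P x} \<subseteq> N"
    using assms[unfolded AE_completion_iff] unfolding eventually_ae_filter by auto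
  have "N \<times> (UNIV :: 'b set) \<in> null_sets lborel"
    using N by (auto simp: null_sets_def lborel_prod[symmetric] lborel.emeasure_pair_measure_Times)
  then have "AE p in (lborel :: ('a \<times> 'b) measure). P (fst p)"
    by (rule AE_I') (use N in auto)
  then show ?thesis by (rule AE_completion)
qed

lemma AE_lebesgue_snd:
  assumes "AE x in lebesgue. P x"
  shows "AE p in (lebesgue :: ('a::euclidean_space \<times> 'b::euclidean_space) measure). P (snd p)"
proof -
  obtain N where N: "N \<in> null_sets lborel" "{x. \<not> P x} \<subseteq> N"
    using assms[unfolded AE_completion_iff] unfolding eventually_ae_filter by auto
  have "(UNIV :: 'a set) \<times> N \<in> null_sets lborel"
    using N by (auto simp: null_sets_def lborel_prod[symmetric] lborel.emeasure_pair_measure_Times)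
  then have "AE p in (lborel :: ('a \<times> 'b) measure). P (snd p)"
    by (rule AE_I') (use N in auto)
  then show ?thesis by (rule AE_completion)
qed

text \<open>The bound on \<open>K\<close> holds at every point, not only almost everywhere, so that
  each slice \<open>K (x, _)\<close> can later serve as an integrable test function on the unit
  interval.\<close>

lemma borel_kernel_version:
  fixes W :: "real \<Rightarrow> real \<Rightarrow> real"
  assumes W: "(\<lambda>p. W (fst p) (snd p)) \<in> borel_measurable square_leb"
    and bW: "\<And>x y. x \<in> {0..1} \<Longrightarrow> y \<in> {0..1} \<Longrightarrow> \<bar>W x y\<bar> \<le> 1"
  obtains K :: "real \<times> real \<Rightarrow> real" where "K \<in> borel_measurable borel" "\<And>p. \<bar>K p\<bar> \<le> 1"
    "AE p in lebesgue. indicator unit_sq p * W (fst p) (snd p) = K p"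
proof -
  obtain K where K: "K \<in> borel_measurable borel" "AE p in lebesgue. indicator unit_sq p * W (fst p) (snd p) = K p"
    using borel_version_lebesgue_on[OF unit_sq_lebesgue W] by blast
  \<comment> \<open>Truncation to [-1, 1] preserves the almost everywhere equality, because the zero
    extension of \<open>W\<close> already takes values there.\<close>
  define K' where "K' p = max (-1) (min 1 (K p))" for p
  have "AE p in lebesgue. indicator unit_sq p * W (fst p) (snd p) = K' p"
    using K(2)
  proof eventually_elim
    case (elim p)
    have "\<bar>indicator unit_sq p * W (fst p) (snd p)\<bar> \<le> 1"
      using bW[of "fst p" "snd p"] by (cases p) (auto simp: indicator_def)
    with elim show ?case unfolding K'_def by auto
  qed
  moreover have "K' \<in> borel_measurable borel" unfolding K'_def using K(1) by measurable
  moreover have "\<bar>K' p\<bar> \<le> 1" for p unfolding K'_def by auto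
  ultimately show ?thesis using that by blast
qed

lemma integrable_square_product:
  fixes W :: "real \<Rightarrow> real \<Rightarrow> real"
  assumes W: "(\<lambda>p. W (fst p) (snd p)) \<in> borel_measurable square_leb"
    and bW: "\<And>x y. x \<in> {0..1} \<Longrightarrow> y \<in> {0..1} \<Longrightarrow> \<bar>W x y\<bar> \<le> 1"
    and a: "a \<in> borel_measurable unit_leb" "\<And>x. x \<in> {0..1} \<Longrightarrow> \<bar>a x\<bar> \<le> 1"
    and b: "b \<in> borel_measurable unit_leb" "\<And>x. x \<in> {0..1} \<Longrightarrow> \<bar>b x\<bar> \<le> 1"
  shows "integrable square_leb (\<lambda>p. W (fst p) (snd p) * (a (fst p) * b (snd p)))"
proof (rule square_leb.integrable_const_bound[where B = 1])
  show "AE p in square_leb. norm (W (fst p) (snd p) * (a (fst p) * b (snd p))) \<le> 1"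
    using bW a(2) b(2) by (auto intro!: AE_I2 mult_le_one simp: abs_mult)
  show "(\<lambda>p. W (fst p) (snd p) * (a (fst p) * b (snd p))) \<in> borel_measurable square_leb"
    using W measurable_compose[OF measurable_fst_square a(1)] measurable_compose[OF measurable_snd_square b(1)]
    by measurable
qed

text \<open>Fubini for the completed measure: pass to Borel versions of all three factors, integrate
  iteratedly over \<open>lborel\<close>, then return to \<open>a\<close> and \<open>b\<close>. The
  kernel stays in its Borel version, since a slice of \<open>W\<close> itself is controlled only for
  almost every \<open>x\<close>.\<close>

lemma integral_square_iterated:
  fixes W :: "real \<Rightarrow> real \<Rightarrow> real"
  assumes W: "(\<lambda>p. W (fst p) (snd p)) \<in> borel_measurable square_leb"
    and bW: "\<And>x y. x \<in> {0..1} \<Longrightarrow> y \<in> {0..1} \<Longrightarrow> \<bar>W x y\<bar> \<le> 1"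
    and K: "K \<in> borel_measurable borel"
    and WK: "AE p in lebesgue. indicator unit_sq p * W (fst p) (snd p) = K p"
    and a: "a \<in> borel_measurable unit_leb" "\<And>x. x \<in> {0..1} \<Longrightarrow> \<bar>a x\<bar> \<le> 1"
    and b: "b \<in> borel_measurable unit_leb" "\<And>x. x \<in> {0..1} \<Longrightarrow> \<bar>b x\<bar> \<le> 1"
  shows "(LINT p|square_leb. W (fst p) (snd p) * (a (fst p) * b (snd p)))
    = (LINT x|unit_leb. a x * (LINT y|unit_leb. K (x, y) * b y))"
proof -
  obtain a' where a': "a' \<in> borel_measurable borel" "AE x in lebesgue. indicator {0..1} x * a x = a' x"
    using borel_version_lebesgue_on[OF _ a(1)] by auto
  obtain b' where b': "b' \<in> borel_measurable borel" "AE x in lebesgue. indicator {0..1} x * b x = b' x"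
    using borel_version_lebesgue_on[OF _ b(1)] by auto
  note [measurable] = a'(1) b'(1) K
  have bm: "(\<lambda>x. indicator {0..1} x * b x) \<in> borel_measurable lebesgue"
    "(\<lambda>x. indicator {0..1} x * a x) \<in> borel_measurable lebesgue"
    using a(1) b(1) by (auto simp: borel_measurable_restrict_space_iff)
  define F where "F p = indicator unit_sq p * (W (fst p) (snd p) * (a (fst p) * b (snd p)))" for p
  define G where "G p = K p * (a' (fst p) * b' (snd p))" for p
  have Gb: "G \<in> borel_measurable borel"
    unfolding G_def using K unfolding borel_prod[symmetric] by measurable
  have iF: "integrable lebesgue F"
    using integrable_square_product[of W a b] W bW a b unfolding F_def
    by (subst (asm) integrable_restrict_space) auto
  have FG: "AE p in lebesgue. F p = G p"
    using WK AE_lebesgue_fst[OF a'(2)] AE_lebesgue_snd[OF b'(2)]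
  proof eventually_elim
    case (elim p)
    have "F p = (indicator unit_sq p * W (fst p) (snd p)) * ((indicator {0..1} (fst p) * a (fst p)) * (indicator {0..1} (snd p) * b (snd p)))"
      unfolding F_def by (cases p) (auto simp: indicator_def)
    then show ?case unfolding G_def elim .
  qed
  have G_leb: "G \<in> borel_measurable lebesgue" using Gb by (simp add: measurable_completion)
  have "integrable lebesgue G"
    using iF FG G_leb by (subst integrable_cong_AE[where g = F]) auto
  then have iG: "integrable (lborel \<Otimes>\<^sub>M lborel) G"
    using Gb by (simp add: integrable_completion lborel_prod)
  have "(LINT p|square_leb. W (fst p) (snd p) * (a (fst p) * b (snd p))) = integral\<^sup>L lebesgue F"
    unfolding F_def by (subst integral_restrict_space) auto
  also have "\<dots> = integral\<^sup>L lebesgue G"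
    using FG G_leb iF by (intro integral_cong_AE) auto
  also have "\<dots> = integral\<^sup>L (lborel \<Otimes>\<^sub>M lborel) G"
    using Gb by (simp add: integral_completion lborel_prod)
  also have "\<dots> = (LINT x|lborel. LINT y|lborel. G (x, y))"
    by (rule lborel_pair.integral_fst'[symmetric, OF iG])
  also have "\<dots> = (LINT x|lborel. a' x * (LINT y|lborel. K (x, y) * b' y))"
    unfolding G_def by (simp add: mult_ac)
  also have "\<dots> = (LINT x|lborel. a' x * (LINT y|unit_leb. K (x, y) * b y))"
  proof -
    \<comment> \<open>The null set where \<open>b'\<close> differs from the zero extension of
      \<open>b\<close> does not depend on \<open>x\<close>, so the inner integrals agree for every
      \<open>x\<close>.\<close>
    have "(LINT y|lborel. K (x, y) * b' y) = (LINT y|unit_leb. K (x, y) * b y)" for x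
    proof -
      have [measurable]: "(\<lambda>y. K (x, y)) \<in> borel_measurable borel"
        using K by (simp add: borel_prod[symmetric])
      have [measurable]: "(\<lambda>y. K (x, y)) \<in> borel_measurable lebesgue"
        by (rule measurable_completion) simp
      have "(LINT y|lborel. K (x, y) * b' y) = (LINT y|lebesgue. K (x, y) * b' y)"
        by (subst integral_completion) auto
      also have "\<dots> = (LINT y|lebesgue. K (x, y) * (indicator {0..1} y * b y))"
        using b'(2) bm by (intro integral_cong_AE) (auto intro!: borel_measurable_times measurable_completion)
      also have "\<dots> = (LINT y|unit_leb. K (x, y) * b y)"
        by (subst integral_restrict_space) (auto simp: mult_ac)
      finally show ?thesis .
    qed
    then show ?thesis by simp
  qed
  also have "\<dots> = (LINT x|unit_leb. a x * (LINT y|unit_leb. K (x, y) * b y))"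
  proof -
    define h where "h x = (LINT y|unit_leb. K (x, y) * b y)" for x
    \<comment> \<open>The product has a Borel first factor and a completed second one: this
      accommodates \<open>b\<close>, which is merely Lebesgue measurable, and still makes
      \<open>h\<close> Borel in \<open>x\<close>.\<close>
    have "(\<lambda>p. K p * b (snd p)) \<in> borel_measurable (borel \<Otimes>\<^sub>M unit_leb)"
    proof -
      have id: "(\<lambda>y::real. y) \<in> unit_leb \<rightarrow>\<^sub>M borel"
        using id_borel_measurable_lebesgue_on by (simp add: id_def)
      have "(\<lambda>p. (fst p, snd p)) \<in> borel \<Otimes>\<^sub>M unit_leb \<rightarrow>\<^sub>M (borel \<Otimes>\<^sub>M borel :: (real \<times> real) measure)"
        by (intro measurable_Pair measurable_compose[OF measurable_snd id]) auto
      from measurable_compose[OF this, of K borel] show ?thesis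
        using K measurable_compose[OF measurable_snd b(1)]
        by (intro borel_measurable_times) (auto simp: borel_prod)
    qed
    then have [measurable]: "h \<in> borel_measurable borel"
      unfolding h_def by (intro unit_leb.borel_measurable_lebesgue_integral) (simp add: case_prod_beta')
    have "(LINT x|lborel. a' x * h x) = (LINT x|lebesgue. a' x * h x)"
      by (subst integral_completion) auto
    also have "\<dots> = (LINT x|lebesgue. (indicator {0..1} x * a x) * h x)"
    proof (rule integral_cong_AE)
      show "(\<lambda>x. a' x * h x) \<in> borel_measurable lebesgue"
        by (rule measurable_completion) simp
      show "(\<lambda>x. (indicator {0..1} x * a x) * h x) \<in> borel_measurable lebesgue"
        by (intro borel_measurable_times bm(2) measurable_completion) simp
    qed (use a'(2) in auto)
    also have "\<dots> = (LINT x|unit_leb. a x * h x)"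
      by (subst integral_restrict_space) (auto simp: mult_ac)
    finally show ?thesis unfolding h_def .
  qed
  finally show ?thesis .
qed

section \<open>Weak convergence\<close>

text \<open>Weak-* convergence in L^infinity tested against L^1: the scalar form of what
  \<open>narrow_conv\<close> demands for each continuous test function.\<close>

definition weakly_converges :: "(nat \<Rightarrow> real \<Rightarrow> real) \<Rightarrow> (real \<Rightarrow> real) \<Rightarrow> bool" where
  "weakly_converges a a0 \<longleftrightarrow> (\<forall>\<phi>. integrable unit_leb \<phi> \<longrightarrow>
     (\<lambda>n. LINT x|unit_leb. \<phi> x * a n x) \<longlonglongrightarrow> (LINT x|unit_leb. \<phi> x * a0 x))"

lemma integrable_mult_bounded:
  fixes \<phi> d :: "'a \<Rightarrow> real"
  assumes "integrable M \<phi>" "d \<in> borel_measurable M" "\<And>x. x \<in> space M \<Longrightarrow> \<bar>d x\<bar> \<le> 1"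
  shows "integrable M (\<lambda>x. \<phi> x * d x)"
  by (rule Bochner_Integration.integrable_bound[OF assms(1)])
     (use assms in \<open>auto intro!: AE_I2 mult_left_le simp: abs_mult\<close>)

text \<open>Products of weakly converging sequences need not converge to the product of the limits.
  Here the kernel smooths one factor: \<open>h (b n) x\<close> tests \<open>b n\<close> against the
  slice \<open>K (x, _)\<close>, so it converges for each \<open>x\<close>, and dominated
  convergence makes this strong convergence in L^1.\<close>

lemma weakly_converges_bilinear:
  assumes K: "K \<in> borel_measurable borel" "\<And>p. \<bar>K p\<bar> \<le> 1"
    and a: "\<And>n. a n \<in> borel_measurable unit_leb" "\<And>n x. x \<in> {0..1} \<Longrightarrow> \<bar>a n x\<bar> \<le> 1"
    and b: "\<And>n. b n \<in> borel_measurable unit_leb" "\<And>n x. x \<in> {0..1} \<Longrightarrow> \<bar>b n x\<bar> \<le> 1"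
    and b0: "b0 \<in> borel_measurable unit_leb" "\<And>x. x \<in> {0..1} \<Longrightarrow> \<bar>b0 x\<bar> \<le> 1"
    and wa: "weakly_converges a a0" and wb: "weakly_converges b b0"
  shows "(\<lambda>n. LINT x|unit_leb. a n x * (LINT y|unit_leb. K (x, y) * b n y))
    \<longlonglongrightarrow> (LINT x|unit_leb. a0 x * (LINT y|unit_leb. K (x, y) * b0 y))"
proof -
  define h where "h c x = (LINT y|unit_leb. K (x, y) * c y)" for c x
  have id: "(\<lambda>y::real. y) \<in> unit_leb \<rightarrow>\<^sub>M borel"
    using id_borel_measurable_lebesgue_on by (simp add: id_def)
  have K1: "(\<lambda>y. K (x, y)) \<in> borel_measurable unit_leb" for x
    using K(1) by (intro measurable_compose[OF id]) (simp add: borel_prod[symmetric])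
  have iK: "integrable unit_leb (\<lambda>y. K (x, y))" for x
    by (rule unit_leb.integrable_const_bound[where B = 1]) (use K K1 in auto)
  have hm: "h c \<in> borel_measurable unit_leb" if c: "c \<in> borel_measurable unit_leb" for c
  proof -
    have "(\<lambda>p. (fst p, snd p)) \<in> unit_leb \<Otimes>\<^sub>M unit_leb \<rightarrow>\<^sub>M (borel \<Otimes>\<^sub>M borel :: (real \<times> real) measure)"
      by (intro measurable_Pair measurable_compose[OF measurable_snd id] measurable_compose[OF measurable_fst id])
    from measurable_compose[OF this, of K borel]
    have "(\<lambda>p. K p * c (snd p)) \<in> borel_measurable (unit_leb \<Otimes>\<^sub>M unit_leb)"
      using K measurable_compose[OF measurable_snd c]
      by (intro borel_measurable_times) (auto simp: borel_prod)
    then show ?thesis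
      unfolding h_def by (intro unit_leb.borel_measurable_lebesgue_integral) (simp add: case_prod_beta')
  qed
  have hb: "\<bar>h c x\<bar> \<le> 1" if c: "c \<in> borel_measurable unit_leb" "\<And>x. x \<in> {0..1} \<Longrightarrow> \<bar>c x\<bar> \<le> 1" for c x
  proof -
    have "\<bar>h c x\<bar> \<le> (LINT y|unit_leb. \<bar>K (x, y) * c y\<bar>)"
      unfolding h_def by (rule integral_abs_bound)
    also have "\<dots> \<le> (LINT y|unit_leb. 1)"
      using iK c K(2) by (intro integral_mono integrable_abs integrable_mult_bounded)
        (auto simp: abs_mult intro!: mult_le_one)
    also have "\<dots> = 1" by (simp add: unit_leb.prob_space[simplified])
    finally show ?thesis .
  qed
  have hc: "(\<lambda>n. h (b n) x) \<longlonglongrightarrow> h b0 x" for x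
    using wb iK unfolding weakly_converges_def h_def by blast
  note hmb = hm[OF b(1)] hb[OF b]
  note hm0 = hm[OF b0(1)] hb[OF b0]
  have ih: "integrable unit_leb (h (b n))" for n
    by (rule unit_leb.integrable_const_bound[where B = 1]) (use hmb in auto)
  have ih0: "integrable unit_leb (h b0)"
    by (rule unit_leb.integrable_const_bound[where B = 1]) (use hm0 in auto)
  have "(\<lambda>n. LINT x|unit_leb. \<bar>h (b n) x - h b0 x\<bar>) \<longlonglongrightarrow> (LINT x|unit_leb. 0)"
  proof (rule integral_dominated_convergence[where w = "\<lambda>_. 2"])
    show "AE x in unit_leb. (\<lambda>n. \<bar>h (b n) x - h b0 x\<bar>) \<longlonglongrightarrow> 0"
      using hc by (intro AE_I2 tendsto_rabs_zero LIM_zero)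
    show "AE x in unit_leb. norm \<bar>h (b n) x - h b0 x\<bar> \<le> 2" for n
      using hmb(2)[of n] hm0(2) by (intro AE_I2) (smt (verit) real_norm_def)
  qed (use hmb hm0 in auto)
  then have lim0: "(\<lambda>n. LINT x|unit_leb. \<bar>h (b n) x - h b0 x\<bar>) \<longlonglongrightarrow> 0" by simp
  \<comment> \<open>Split \<open>a n * h (b n)\<close> into \<open>a n * h b0\<close>, handled by
    weak convergence of \<open>a\<close>, and this remainder, bounded by the L^1 distance of
    \<open>h (b n)\<close> and \<open>h b0\<close> because the \<open>a n\<close> are bounded by
    1.\<close>
  have "(\<lambda>n. LINT x|unit_leb. a n x * (h (b n) x - h b0 x)) \<longlonglongrightarrow> 0"
  proof (rule tendsto_rabs_zero_cancel, rule tendsto_sandwich[OF _ _ tendsto_const lim0])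
    have "\<bar>LINT x|unit_leb. a n x * (h (b n) x - h b0 x)\<bar> \<le> (LINT x|unit_leb. \<bar>h (b n) x - h b0 x\<bar>)" for n
    proof -
      have "\<bar>LINT x|unit_leb. a n x * (h (b n) x - h b0 x)\<bar> \<le> (LINT x|unit_leb. \<bar>(h (b n) x - h b0 x) * a n x\<bar>)"
        using integral_abs_bound by (simp add: mult.commute)
      also have "\<dots> \<le> (LINT x|unit_leb. \<bar>h (b n) x - h b0 x\<bar>)"
        using ih ih0 a by (intro integral_mono integrable_abs integrable_mult_bounded)
          (auto simp: abs_mult intro!: mult_left_le)
      finally show ?thesis .
    qed
    then show "\<forall>\<^sub>F n in sequentially. \<bar>LINT x|unit_leb. a n x * (h (b n) x - h b0 x)\<bar> \<le> (LINT x|unit_leb. \<bar>h (b n) x - h b0 x\<bar>)"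
      by simp
  qed auto
  moreover have "(\<lambda>n. LINT x|unit_leb. h b0 x * a n x) \<longlonglongrightarrow> (LINT x|unit_leb. h b0 x * a0 x)"
    using wa ih0 unfolding weakly_converges_def by blast
  ultimately have "(\<lambda>n. (LINT x|unit_leb. h b0 x * a n x) + (LINT x|unit_leb. a n x * (h (b n) x - h b0 x)))
     \<longlonglongrightarrow> (LINT x|unit_leb. h b0 x * a0 x) + 0"
    by (intro tendsto_add)
  moreover have "(LINT x|unit_leb. h b0 x * a n x) + (LINT x|unit_leb. a n x * (h (b n) x - h b0 x))
     = (LINT x|unit_leb. a n x * h (b n) x)" for n
  proof -
    have "integrable unit_leb (\<lambda>x. h b0 x * a n x)" "integrable unit_leb (\<lambda>x. a n x * (h (b n) x - h b0 x))"
      using integrable_mult_bounded[OF ih0 a(1), of n]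
        integrable_mult_bounded[OF Bochner_Integration.integrable_diff[OF ih[of n] ih0] a(1), of n] a(2)
      by (auto simp: mult.commute)
    then show ?thesis
      by (subst Bochner_Integration.integral_add[symmetric]) (auto simp: algebra_simps)
  qed
  ultimately show ?thesis by (simp add: h_def mult.commute)
qed

text \<open>Dynkin's pi-lambda argument: half-lines are closed under intersection and generate the
  Borel sets, and the sets with vanishing limit are closed under complements and countable disjoint
  unions. Unions are where the uniform bound on \<open>d n\<close> enters.\<close>

lemma weakly_converges_zero_borel:
  fixes d :: "nat \<Rightarrow> real \<Rightarrow> real"
  assumes d: "\<And>n. d n \<in> borel_measurable unit_leb" "\<And>n x. x \<in> {0..1} \<Longrightarrow> \<bar>d n x\<bar> \<le> 1"
    and lim: "\<And>t. t \<in> {0..1} \<Longrightarrow> (\<lambda>n. LINT x|unit_leb. indicator {..t} x * d n x) \<longlonglongrightarrow> 0"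
    and S: "S \<in> sets (borel :: real measure)"
  shows "(\<lambda>n. LINT x|unit_leb. indicator S x * d n x) \<longlonglongrightarrow> 0"
proof -
  have sub: "S \<inter> {0..1} \<in> sets unit_leb" if "S \<in> sets borel" for S
    using that by (subst sets_restrict_space_iff) auto
  have idn: "integrable unit_leb (d n)" for n
    by (rule unit_leb.integrable_const_bound[where B = 1]) (use d in auto)
  have ind_eq: "(LINT x|unit_leb. indicator S x * d n x) = (LINT x|unit_leb. indicator (S \<inter> {0..1}) x * d n x)" for S n
    by (intro Bochner_Integration.integral_cong) (auto simp: indicator_def)
  have iS: "integrable unit_leb (\<lambda>x. indicator (S \<inter> {0..1}) x * d n x)" if "S \<in> sets borel" for n S
    using integrable_real_mult_indicator[OF sub[OF that] idn] by (simp add: mult.commute)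
  have "Int_stable (range (atMost :: real \<Rightarrow> real set))"
    by (auto simp: Int_stable_def)
  moreover have "range (atMost :: real \<Rightarrow> real set) \<subseteq> Pow UNIV" by auto
  moreover have "S \<in> sigma_sets UNIV (range (atMost :: real \<Rightarrow> real set))"
    using S by (simp add: borel_eq_atMost)
  ultimately show ?thesis
  proof (induction rule: sigma_sets_induct_disjoint)
    case (basic A)
    then obtain t where A: "A = {..t}" by auto
    \<comment> \<open>Only the trace on the unit interval counts: half-lines to the left of it
      integrate to 0, those reaching beyond 1 behave like \<open>{..1}\<close>.\<close>
    consider "t < 0" | "t \<in> {0..1}" | "t > 1" by fastforce
    then show ?case
    proof cases
      case 1
      then have "(LINT x|unit_leb. indicator A x * d n x) = (LINT x|unit_leb. 0)" for n
        unfolding A by (intro Bochner_Integration.integral_cong) (auto simp: indicator_def)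
      then show ?thesis by simp
    next
      case 2
      then show ?thesis unfolding A by (rule lim)
    next
      case 3
      then have "(LINT x|unit_leb. indicator A x * d n x) = (LINT x|unit_leb. indicator {..1} x * d n x)" for n
        unfolding A by (intro Bochner_Integration.integral_cong) (auto simp: indicator_def)
      then show ?thesis using lim[of 1] by simp
    qed
  next
    case empty
    then show ?case by simp
  next
    case (compl A)
    have "A \<in> sets borel" using compl by (simp add: borel_eq_atMost)
    have "(LINT x|unit_leb. indicator (UNIV - A) x * d n x)
        = (LINT x|unit_leb. indicator {..1} x * d n x) - (LINT x|unit_leb. indicator A x * d n x)" for n
    proof -
      have "(LINT x|unit_leb. indicator {..1} x * d n x) = (LINT x|unit_leb. d n x)"
        by (intro Bochner_Integration.integral_cong) (auto simp: indicator_def)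
      moreover have "(LINT x|unit_leb. indicator (UNIV - A) x * d n x) = (LINT x|unit_leb. d n x - indicator (A \<inter> {0..1}) x * d n x)"
        by (intro Bochner_Integration.integral_cong) (auto simp: indicator_def)
      ultimately show ?thesis
        using idn iS[OF \<open>A \<in> sets borel\<close>] by (simp add: ind_eq[of A])
    qed
    then show ?case using tendsto_diff[OF lim[of 1] compl(2)] by simp
  next
    case (union A)
    have Ab: "A k \<in> sets borel" for k using union by (auto simp: borel_eq_atMost)
    define B where "B k = A k \<inter> {0..1}" for k
    have B: "B k \<in> sets unit_leb" for k unfolding B_def by (rule sub[OF Ab])
    have dB: "disjoint_family B" using union(1) unfolding B_def disjoint_family_on_def by blast
    define M where "M k = measure unit_leb (B k)" for k
    \<comment> \<open>The measures of the disjoint pieces form a summable majorant independent of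
      \<open>n\<close>, which lets Tannery's theorem exchange the limit in \<open>n\<close> with the
      sum over \<open>k\<close>.\<close>
    have sM: "summable M"
      using unit_leb.finite_measure_UNION[OF _ dB] B unfolding M_def by (auto simp: sums_iff)
    define I where "I k n = (LINT x|unit_leb. indicator (B k) x * d n x)" for k n
    have Ilim: "(\<lambda>n. I k n) \<longlonglongrightarrow> 0" for k
      using union(3)[of k] by (simp add: I_def B_def ind_eq[of "A k"])
    have Ib: "norm (I k n) \<le> M k" for k n
    proof -
      have "\<bar>I k n\<bar> \<le> (LINT x|unit_leb. \<bar>indicator (B k) x * d n x\<bar>)"
        unfolding I_def by (rule integral_abs_bound)
      also have "\<dots> \<le> (LINT x|unit_leb. indicator (B k) x)"
        using iS[OF Ab[of k], of n] d(2)
          integrable_real_indicator[OF B[of k] unit_leb.emeasure_finite[of "B k", unfolded less_top, folded infinity_ennreal_def]]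
        by (intro integral_mono integrable_abs) (auto simp: B_def[symmetric] abs_mult mult_left_le split: split_indicator)
      also have "\<dots> = measure unit_leb (B k)" by (simp add: B_def Int_assoc)
      finally show ?thesis by (simp add: M_def)
    qed
    have "(LINT x|unit_leb. indicator (\<Union>i. A i) x * d n x) = (\<Sum>k. I k n)" for n
    proof -
      have "(LINT x|unit_leb. indicator (\<Union>i. A i) x * d n x) = (LINT x|unit_leb. indicator (\<Union>i. B i) x * d n x)"
        by (intro Bochner_Integration.integral_cong) (auto simp: indicator_def B_def)
      also have "\<dots> = (\<Sum>k. I k n)"
        using lebesgue_integral_countable_add[of B unit_leb "d n"] B dB idn[of n]
          integrable_real_mult_indicator[of "\<Union>i. B i" unit_leb, OF _ idn]
        by (auto simp: I_def set_lebesgue_integral_def set_integrable_def disjoint_family_on_def mult.commute)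
      finally show ?thesis .
    qed
    moreover have "(\<lambda>n. \<Sum>k. I k n) \<longlonglongrightarrow> (\<Sum>k. 0)"
      using tannerys_theorem[of I "\<lambda>_. 0" sequentially M] Ilim Ib sM by (auto intro: always_eventually)
    ultimately show ?case by simp
  qed
qed

text \<open>Extends the test functions from indicators of initial intervals to all of L^1 by the
  standard induction: indicators, sums, and L^1 limits, the last by the uniform bound on
  \<open>d n\<close>.\<close>

lemma weakly_converges_zero:
  fixes d :: "nat \<Rightarrow> real \<Rightarrow> real"
  assumes d: "\<And>n. d n \<in> borel_measurable unit_leb" "\<And>n x. x \<in> {0..1} \<Longrightarrow> \<bar>d n x\<bar> \<le> 1"
    and lim: "\<And>t. t \<in> {0..1} \<Longrightarrow> (\<lambda>n. LINT x|unit_leb. indicator {..t} x * d n x) \<longlonglongrightarrow> 0"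
  shows "weakly_converges d (\<lambda>_. 0)"
  unfolding weakly_converges_def
proof (intro allI impI)
  fix \<phi> :: "real \<Rightarrow> real" assume "integrable unit_leb \<phi>"
  then show "(\<lambda>n. LINT x|unit_leb. \<phi> x * d n x) \<longlonglongrightarrow> (LINT x|unit_leb. \<phi> x * 0)"
  proof (induction rule: integrable_induct)
    case (base A c)
    have A: "A \<in> sets lebesgue" using base by (auto simp: sets_restrict_space_iff)
    \<comment> \<open>The main part is a Borel set that differs from the Lebesgue set
      \<open>A\<close> by a null set, which reduces the claim to the Borel case.\<close>
    define S where "S = main_part lborel A"
    have S: "S \<in> sets borel" unfolding S_def using A by (metis main_part_sets sets_lborel)
    have "AE x in lebesgue. x \<in> S \<longleftrightarrow> x \<in> A"
      unfolding S_def by (rule AE_completion[OF AE_in_main_part[OF A]])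
    then have "AE x in unit_leb. x \<in> S \<longleftrightarrow> x \<in> A"
      by (auto simp: AE_restrict_space_iff)
    moreover have [measurable]: "(\<lambda>x. indicator S x :: real) \<in> borel_measurable unit_leb"
      using S by (intro measurable_restrict_space1 measurable_completion) auto
    ultimately have "(LINT x|unit_leb. (indicator A x *\<^sub>R c) * d n x) = (LINT x|unit_leb. c * (indicator S x * d n x))" for n
      using d(1)[measurable] base(1)[measurable] by (intro integral_cong_AE) (auto split: split_indicator)
    then show ?case
      using tendsto_mult_right_zero[OF weakly_converges_zero_borel[OF d lim S]] by simp
  next
    case (add f g)
    then show ?case
      using integrable_mult_bounded[OF add.hyps(1) d(1)] integrable_mult_bounded[OF add.hyps(2) d(1)] d(2)
        tendsto_add[OF add.IH] by (simp add: ring_distribs)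
  next
    case (lim f s)
    have conv: "(\<lambda>i. LINT x|unit_leb. \<bar>f x - s i x\<bar>) \<longlonglongrightarrow> (LINT x|unit_leb. 0)"
    \<comment> \<open>The approximants of the induction satisfy \<bar>s i x\<bar> \<le> 2 * \<bar>f
      x\<bar>, which gives the factor 3 for the difference.\<close>
    proof (rule integral_dominated_convergence[where w = "\<lambda>x. 3 * \<bar>f x\<bar>"])
      show "AE x in unit_leb. (\<lambda>i. \<bar>f x - s i x\<bar>) \<longlonglongrightarrow> 0"
        by (intro AE_I2 tendsto_rabs_zero tendsto_eq_rhs[OF tendsto_diff[OF tendsto_const lim.hyps(2)]]) auto
      show "AE x in unit_leb. norm \<bar>f x - s i x\<bar> \<le> 3 * \<bar>f x\<bar>" for i
        using lim.hyps(3)[of _ i] by (intro AE_I2) (smt (verit) real_norm_def)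
    qed (use lim.hyps in auto)
    show ?case
    proof (rule LIMSEQ_I)
      fix r :: real assume "r > 0"
      \<comment> \<open>The index \<open>i\<close> is fixed before \<open>n\<close>: the error of
        replacing \<open>f\<close> by \<open>s i\<close> is below r/2 for all \<open>n\<close> at
        once, as \<open>d n\<close> is bounded by 1.\<close>
      then obtain i where i: "(LINT x|unit_leb. \<bar>f x - s i x\<bar>) < r / 2"
        using order_tendstoD(2)[OF conv, of "r/2"] by (auto simp: eventually_sequentially)
      obtain N where N: "\<And>n. n \<ge> N \<Longrightarrow> \<bar>LINT x|unit_leb. s i x * d n x\<bar> < r / 2"
        using LIMSEQ_D[OF lim.IH[of i], of "r/2"] \<open>r > 0\<close> by auto
      have "\<bar>LINT x|unit_leb. f x * d n x\<bar> < r" if "n \<ge> N" for n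
      proof -
        have ints: "integrable unit_leb (\<lambda>x. (f x - s i x) * d n x)" "integrable unit_leb (\<lambda>x. s i x * d n x)"
          using lim.hyps d by (auto intro!: integrable_mult_bounded)
        have "(LINT x|unit_leb. f x * d n x) = (LINT x|unit_leb. (f x - s i x) * d n x) + (LINT x|unit_leb. s i x * d n x)"
          using ints by (subst Bochner_Integration.integral_add[symmetric]) (auto simp: algebra_simps)
        moreover have "\<bar>LINT x|unit_leb. (f x - s i x) * d n x\<bar> \<le> (LINT x|unit_leb. \<bar>(f x - s i x) * d n x\<bar>)"
          by (rule integral_abs_bound)
        moreover have "\<dots> \<le> (LINT x|unit_leb. \<bar>f x - s i x\<bar>)"
          using ints lim.hyps d by (intro integral_mono integrable_abs) (auto simp: abs_mult intro!: mult_left_le)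
        ultimately show ?thesis using i N[OF that] by linarith
      qed
      then show "\<exists>no. \<forall>n\<ge>no. norm ((LINT x|unit_leb. f x * d n x) - (LINT x|unit_leb. f x * 0)) < r"
        by auto
    qed
  qed
qed

section \<open>Greedy labelling of the cells\<close>

text \<open>Greedy rounding: label \<open>k\<close> should receive the share \<open>p j k\<close> in step \<open>j\<close>, and each step is
  given entirely to the label with the smallest surplus.\<close>

primrec surplus :: "'a set \<Rightarrow> (nat \<Rightarrow> 'a \<Rightarrow> real) \<Rightarrow> nat \<Rightarrow> 'a \<Rightarrow> real" where
  "surplus L p 0 = (\<lambda>k. 0)"
| "surplus L p (Suc j) = (\<lambda>k. surplus L p j k - p j k +
     indicator {arg_min_on (\<lambda>k. surplus L p j k - p j k) L} k)"

text \<open>Each step takes away shares of total 1 and hands out one unit, so the sum stays 0. A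
  label not chosen can only lose; the chosen one has the least of the scores \<open>v\<close>, which
  add up to -1, so it is at most 0 before receiving its unit.\<close>

lemma surplus_invariant:
  assumes L: "finite L" "L \<noteq> {}"
    and p: "\<And>i k. i < n \<Longrightarrow> k \<in> L \<Longrightarrow> 0 \<le> p i k" "\<And>i. i < n \<Longrightarrow> (\<Sum>k\<in>L. p i k) = 1"
  shows "j \<le> n \<Longrightarrow> (\<Sum>k\<in>L. surplus L p j k) = 0 \<and> (\<forall>k\<in>L. surplus L p j k \<le> 1)"
proof (induction j)
  case (Suc j)
  define v where "v k = surplus L p j k - p j k" for k
  define m where "m = arg_min_on v L"
  have m: "m \<in> L" "\<And>k. k \<in> L \<Longrightarrow> v m \<le> v k"
    using arg_min_if_finite[OF L, of v] by (auto simp: m_def not_less)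
  have S: "surplus L p (Suc j) k = v k + indicator {m} k" for k
    by (simp add: v_def m_def[unfolded v_def])
  have sv: "(\<Sum>k\<in>L. v k) = -1"
    using Suc p(2)[of j] by (simp add: v_def sum_subtractf)
  have "(\<Sum>k\<in>L. indicator {m} k :: real) = 1"
    using m(1) L(1) by (simp add: indicator_def if_distrib sum.If_cases)
  then have "(\<Sum>k\<in>L. surplus L p (Suc j) k) = 0"
    using sv by (simp only: S sum.distrib)
  moreover have "surplus L p (Suc j) k \<le> 1" if k: "k \<in> L" for k
  proof (cases "k = m")
    case True
    have "v m \<le> 0"
    proof (rule ccontr)
      assume "\<not> v m \<le> 0"
      then have "0 \<le> (\<Sum>k\<in>L. v k)" using m(2) by (intro sum_nonneg) force
      then show False using sv by simp
    qed
    then show ?thesis unfolding S using True by simp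
  next
    case False
    moreover have "surplus L p j k \<le> 1" "0 \<le> p j k" using Suc p(1)[of j k] k by auto
    ultimately show ?thesis unfolding S v_def by simp
  qed
  ultimately show ?case by blast
qed simp

text \<open>The lower bound follows from the upper ones: the surpluses sum to 0, so a deficit of one
  label is the total surplus of the others, each at most 1.\<close>

lemma abs_surplus_le_card:
  assumes L: "finite L" "L \<noteq> {}"
    and p: "\<And>i k. i < n \<Longrightarrow> k \<in> L \<Longrightarrow> 0 \<le> p i k" "\<And>i. i < n \<Longrightarrow> (\<Sum>k\<in>L. p i k) = 1"
    and j: "j \<le> n" and k: "k \<in> L"
  shows "\<bar>surplus L p j k\<bar> \<le> card L"
proof -
  have inv: "(\<Sum>k\<in>L. surplus L p j k) = 0" "\<And>k. k \<in> L \<Longrightarrow> surplus L p j k \<le> 1"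
    using surplus_invariant[OF L p j] by auto
  have "(\<Sum>i\<in>L - {k}. surplus L p j i) \<le> (\<Sum>i\<in>L - {k}. 1)"
    using inv by (intro sum_mono) auto
  also have "\<dots> \<le> card L" using L by (simp add: card_Diff_subset card_mono)
  finally have "- surplus L p j k \<le> card L"
    using inv(1) sum.remove[OF L(1) k, of "surplus L p j"] by simp
  moreover have "1 \<le> card L" using L by (simp add: Suc_leI card_gt_0_iff)
  ultimately show ?thesis using inv(2)[OF k] by simp
qed

lemma integral_unit_leb_cell:
  assumes "j < n"
  shows "(LINT x|unit_leb. indicator {real j / n<..real (Suc j) / n} x) = 1 / real n"
proof -
  have sub: "{real j / n<..real (Suc j) / n} \<subseteq> {0..1}"
  proof
    fix x assume "x \<in> {real j / n<..real (Suc j) / n}"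
    moreover have "0 \<le> real j / n" "real (Suc j) / n \<le> 1" using assms by (auto simp: field_simps)
    ultimately show "x \<in> {0..1}" unfolding atLeastAtMost_iff greaterThanAtMost_iff by linarith
  qed
  have "(LINT x|unit_leb. indicator {real j / n<..real (Suc j) / n} x) = measure unit_leb {real j / n<..real (Suc j) / n}"
    using Int_absorb2[OF sub] by simp
  also have "\<dots> = measure lebesgue {real j / n<..real (Suc j) / n}"
    using sub by (intro measure_restrict_space) auto
  also have "\<dots> = 1 / real n"
    using assms by (simp add: field_simps divide_simps)
  finally show ?thesis .
qed

text \<open>The expression on the left is the zero-based number of the cell containing
  \<open>x\<close>; the cells are open on the left, hence a ceiling rather than a floor.\<close>

lemma ceiling_cell:
  assumes "n > 0" "real j / n < x" "x \<le> real (Suc j) / n"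
  shows "nat \<lceil>real n * x\<rceil> - 1 = j"
proof -
  have "\<lceil>real n * x\<rceil> = int (Suc j)"
    using assms by (intro ceiling_unique) (auto simp: field_simps)
  then show ?thesis by simp
qed

text \<open>Apply the greedy rounding to the cell averages of the weights. The integral of the
  difference between labelling and weight over an initial interval is then a surplus divided by
  \<open>n\<close>, up to one incomplete cell, so it is of order 1/n, and convergence on initial
  intervals suffices.\<close>

lemma exists_weakly_converging_labelling:
  fixes \<theta> :: "'a \<Rightarrow> real \<Rightarrow> real"
  assumes L: "finite L"
    and \<theta>: "\<And>k. k \<in> L \<Longrightarrow> \<theta> k \<in> borel_measurable unit_leb"
      "\<And>k x. k \<in> L \<Longrightarrow> x \<in> {0..1} \<Longrightarrow> 0 \<le> \<theta> k x \<and> \<theta> k x \<le> 1"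
      "AE x in unit_leb. (\<Sum>k\<in>L. \<theta> k x) = 1"
  obtains w :: "nat \<Rightarrow> nat \<Rightarrow> 'a" where "\<And>n i. w n i \<in> L"
    "\<And>k. k \<in> L \<Longrightarrow> weakly_converges (\<lambda>n x. indicator {k} (w n (nat \<lceil>real n * x\<rceil> - 1))) (\<theta> k)"
proof -
  \<comment> \<open>An empty sum cannot equal 1 almost everywhere on a space of measure 1.\<close>
  have L0: "L \<noteq> {}"
  proof
    assume "L = {}"
    then have "AE x in unit_leb. False" using \<theta>(3) by simp
    then show False by simp
  qed
  define cell where "cell n j = {real j / real n<..real (Suc j) / real n}" for n j
  \<comment> \<open>The factor \<open>real n\<close> turns the integral over a cell of length 1/n
    into the average of the weight, so the shares of all labels in one cell add up to 1.\<close>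
  define p where "p n j k = real n * (LINT x|unit_leb. indicator (cell n j) x * \<theta> k x)" for n j k
  define w where "w n j = arg_min_on (\<lambda>k. surplus L (p n) j k - p n j k) L" for n j
  have wL: "w n j \<in> L" for n j
    unfolding w_def using arg_min_if_finite(1)[OF L L0] by blast
  have ind[measurable]: "(indicator S :: real \<Rightarrow> real) \<in> borel_measurable unit_leb" if "S \<in> sets borel" for S
    using that by (intro measurable_restrict_space1 measurable_completion) auto
  have i\<theta>: "integrable unit_leb (\<lambda>x. indicator S x * \<theta> k x)" if "S \<in> sets borel" "k \<in> L" for S k
    using \<theta>(1,2)[OF that(2)] that(1)
    by (intro unit_leb.integrable_const_bound[where B = 1]) (auto split: split_indicator)
  have p0: "0 \<le> p n j k" if "k \<in> L" for n j k
    unfolding p_def using \<theta>(2)[OF that] by (intro mult_nonneg_nonneg integral_nonneg_AE AE_I2) auto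
  have p1: "(\<Sum>k\<in>L. p n j k) = 1" if "j < n" for n j
  proof -
    have "(\<Sum>k\<in>L. p n j k) = n * (LINT x|unit_leb. (\<Sum>k\<in>L. indicator (cell n j) x * \<theta> k x))"
      unfolding p_def using i\<theta> by (subst Bochner_Integration.integral_sum) (auto simp: cell_def sum_distrib_left)
    also have "(LINT x|unit_leb. (\<Sum>k\<in>L. indicator (cell n j) x * \<theta> k x)) = (LINT x|unit_leb. indicator (cell n j) x)"
    proof (rule integral_cong_AE)
      show "(\<lambda>x. \<Sum>k\<in>L. indicator (cell n j) x * \<theta> k x) \<in> borel_measurable unit_leb"
        using i\<theta> by (intro borel_measurable_sum borel_measurable_integrable) (auto simp: cell_def)
      show "AE x in unit_leb. (\<Sum>k\<in>L. indicator (cell n j) x * \<theta> k x) = indicator (cell n j) x"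
        using \<theta>(3) by eventually_elim (simp add: sum_distrib_left[symmetric])
    qed (auto simp: cell_def)
    also have "\<dots> = 1 / real n"
      unfolding cell_def by (rule integral_unit_leb_cell[OF that])
    finally show ?thesis using that by simp
  qed
  define u where "u n k x = (indicator {k} (w n (nat \<lceil>real n * x\<rceil> - 1)) :: real)" for n k x
  have um: "u n k \<in> borel_measurable unit_leb" for n k
    unfolding u_def by (intro measurable_restrict_space1 measurable_completion) simp
  have u01: "0 \<le> u n k x \<and> u n k x \<le> 1" for n k x by (simp add: u_def)
  have "weakly_converges (\<lambda>n. u n k) (\<theta> k)" if k: "k \<in> L" for k
  proof -
    define d where "d n x = u n k x - \<theta> k x" for n x
    have dm[measurable]: "d n \<in> borel_measurable unit_leb" for n
      unfolding d_def using um \<theta>(1)[OF k] by measurable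
    have d1: "\<bar>d n x\<bar> \<le> 1" if "x \<in> {0..1}" for n x
      unfolding d_def using u01[of n k x] \<theta>(2)[OF k that] by auto
    have idn: "integrable unit_leb (\<lambda>x. indicator S x * d n x)" if "S \<in> sets borel" for S n
      using dm d1 that
      by (intro unit_leb.integrable_const_bound[where B = 1]) (auto split: split_indicator)
    \<comment> \<open>Over the next cell the integral of \<open>d n\<close> gains 1/n if that cell
      is labelled \<open>k\<close> and loses \<open>p n j k / n\<close>: this is the recursion of
      \<open>surplus\<close> divided by \<open>n\<close>.\<close>
    have grid: "(LINT x|unit_leb. indicator {..real j / n} x * d n x) = surplus L (p n) j k / n" if "j \<le> n" "n > 0" for n j
      using that
    proof (induction j)
      case 0
      \<comment> \<open>For \<open>j = 0\<close> the half-line meets the unit interval in the single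
        point 0, a null set.\<close>
      have "AE x in unit_leb. x \<noteq> 0"
      proof -
        have "AE x in lebesgue. x \<noteq> (0::real)"
          by (intro AE_completion AE_lborel_singleton)
        then show ?thesis by (auto simp: AE_restrict_space_iff)
      qed
      then have "(LINT x|unit_leb. indicator {..real 0 / n} x * d n x) = (LINT x|unit_leb. 0)"
        by (intro integral_cong_AE) (auto simp: AE_restrict_space_iff split: split_indicator)
      then show ?case by simp
    next
      case (Suc j)
      have "(LINT x|unit_leb. indicator {..real (Suc j) / n} x * d n x)
        = (LINT x|unit_leb. indicator {..real j / n} x * d n x + indicator (cell n j) x * d n x)"
        using Suc.prems by (intro Bochner_Integration.integral_cong)
          (auto simp: cell_def divide_right_mono split: split_indicator dest: order_trans[of _ "real j / n" "real (Suc j) / n"])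
      also have "\<dots> = surplus L (p n) j k / n + (LINT x|unit_leb. indicator (cell n j) x * d n x)"
        using idn Suc by (simp add: cell_def)
      also have "(LINT x|unit_leb. indicator (cell n j) x * d n x) =
         (LINT x|unit_leb. indicator (cell n j) x * indicator {k} (w n j) - indicator (cell n j) x * \<theta> k x)"
        unfolding d_def u_def using ceiling_cell[of n j] Suc.prems
        by (intro Bochner_Integration.integral_cong) (auto simp: cell_def split: split_indicator)
      also have "\<dots> = indicator {k} (w n j) / n - p n j k / n"
      proof -
        have "integrable unit_leb (indicator (cell n j) :: real \<Rightarrow> real)"
          by (rule unit_leb.integrable_const_bound[where B = 1]) (auto simp: cell_def split: split_indicator)
        moreover have "(LINT x|unit_leb. indicator (cell n j) x) = 1 / real n"
          unfolding cell_def using Suc.prems by (intro integral_unit_leb_cell) simp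
        ultimately show ?thesis
          using i\<theta>[of "cell n j" k] k Suc.prems
          by (subst Bochner_Integration.integral_diff) (auto simp: p_def cell_def simp del: Bochner_Integration.integral_indicator)
      qed
      also have "surplus L (p n) j k / n + (indicator {k} (w n j) / n - p n j k / n) = surplus L (p n) (Suc j) k / n"
      proof -
        have "surplus L (p n) (Suc j) k = surplus L (p n) j k - p n j k + indicator {k} (w n j)"
          by (auto simp: w_def split: split_indicator)
        then show ?thesis by (simp add: add_divide_distrib diff_divide_distrib del: surplus.simps)
      qed
      finally show ?case .
    qed
    have "weakly_converges d (\<lambda>_. 0)"
    proof (rule weakly_converges_zero[OF dm d1])
      fix t :: real assume t: "t \<in> {0..1}"
      have bound: "\<bar>LINT x|unit_leb. indicator {..t} x * d n x\<bar> \<le> (card L + 1) / real n" if n: "n > 0" for n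
      proof -
        \<comment> \<open>\<open>j / n\<close> is the last grid point not beyond \<open>t\<close>;
          the rest of the interval has length at most 1/n, which accounts for the 1 added to
          \<open>card L\<close>.\<close>
        define j where "j = nat \<lfloor>real n * t\<rfloor>"
        have jt: "real j \<le> real n * t" "real n * t < real j + 1" using t unfolding j_def by auto
        have jn: "j \<le> n"
        proof -
          have "real n * t \<le> real n" using t by (simp add: mult_left_le)
          then show ?thesis using jt by linarith
        qed
        have jt': "real j / n \<le> t" "t \<le> real (Suc j) / n" using jt n by (auto simp: field_simps)
        define r where "r = (LINT x|unit_leb. indicator {real j / n<..t} x * d n x)"
        have "(LINT x|unit_leb. indicator {..t} x * d n x) = (LINT x|unit_leb. indicator {..real j / n} x * d n x + indicator {real j / n<..t} x * d n x)"
          using jt' by (intro Bochner_Integration.integral_cong) (auto split: split_indicator)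
        also have "\<dots> = surplus L (p n) j k / n + r"
          using idn grid[OF jn n] by (simp add: r_def)
        finally have eq: "(LINT x|unit_leb. indicator {..t} x * d n x) = surplus L (p n) j k / n + r" .
        have "\<bar>r\<bar> \<le> (LINT x|unit_leb. \<bar>indicator {real j / n<..t} x * d n x\<bar>)"
          unfolding r_def by (rule integral_abs_bound)
        also have "\<dots> \<le> (LINT x|unit_leb. indicator {real j / n<..t} x)"
          using idn[of "{real j / n<..t}"] d1
          by (intro integral_mono integrable_abs unit_leb.integrable_const_bound[where B = 1 and f = "indicator {real j / n<..t}"])
             (auto simp: abs_mult split: split_indicator)
        also have "\<dots> = measure unit_leb ({real j / n<..t} \<inter> {0..1})" by simp
        also have "\<dots> = measure lebesgue ({real j / n<..t} \<inter> {0..1})"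
          by (intro measure_restrict_space) auto
        also have "\<dots> \<le> measure lebesgue {real j / n<..t}"
          by (intro measure_mono_fmeasurable bounded_set_imp_lmeasurable bounded_subset[OF bounded_closed_interval[of "real j / n" t]]) auto
        also have "\<dots> \<le> 1 / n" using jt' by (simp add: add_divide_distrib)
        finally have "\<bar>r\<bar> \<le> 1 / n" .
        moreover have "\<bar>surplus L (p n) j k / n\<bar> \<le> card L / n"
          using abs_surplus_le_card[OF L L0, of n "p n" j k] p0 p1 jn k n by (simp add: divide_right_mono)
        moreover have "(card L + 1) / real n = card L / n + 1 / n" by (simp add: add_divide_distrib)
        ultimately show ?thesis unfolding eq by linarith
      qed
      have "(\<lambda>n. (card L + 1) / real n) \<longlonglongrightarrow> 0"
        by (rule lim_const_over_n)
      then show "(\<lambda>n. LINT x|unit_leb. indicator {..t} x * d n x) \<longlonglongrightarrow> 0"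
        by (rule Lim_null_comparison[rotated]) (use bound in \<open>auto intro: eventually_sequentiallyI[of 1]\<close>)
    qed
    show ?thesis unfolding weakly_converges_def
    proof (intro allI impI)
      fix \<phi> :: "real \<Rightarrow> real" assume \<phi>: "integrable unit_leb \<phi>"
      have "(LINT x|unit_leb. \<phi> x * u n k x) - (LINT x|unit_leb. \<phi> x * \<theta> k x) = (LINT x|unit_leb. \<phi> x * d n x)" for n
        using integrable_mult_bounded[OF \<phi> um] u01 integrable_mult_bounded[OF \<phi> \<theta>(1)[OF k]] \<theta>(2)[OF k]
        by (subst Bochner_Integration.integral_diff[symmetric]) (auto simp: d_def algebra_simps)
      then show "(\<lambda>n. LINT x|unit_leb. \<phi> x * u n k x) \<longlonglongrightarrow> (LINT x|unit_leb. \<phi> x * \<theta> k x)"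
        using \<open>weakly_converges d (\<lambda>_. 0)\<close> \<phi> unfolding weakly_converges_def
        by (subst LIM_zero_iff[symmetric]) simp
    qed
  qed
  then show ?thesis using that wL unfolding u_def by blast
qed

section \<open>Energies of Young measures\<close>

definition bil :: "(real \<Rightarrow> real \<Rightarrow> real) \<Rightarrow> (real \<Rightarrow> real) \<Rightarrow> (real \<Rightarrow> real) \<Rightarrow> real" where
  "bil U a b = (LINT p|square_leb. U (fst p) (snd p) * (a (fst p) * b (snd p)))"

definition mass :: "(real \<Rightarrow> real measure) \<Rightarrow> real \<Rightarrow> real \<Rightarrow> real" where
  "mass \<nu> k x = measure (\<nu> x) {k}"

text \<open>A continuous stand-in for the indicator of the point \<open>k\<close>, with slope
  \<open>m\<close>: Young measures and narrow convergence are tested by continuous functions only,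
  whereas the weight of a label is the mass of a point.\<close>

definition tent :: "nat \<Rightarrow> real \<Rightarrow> real \<Rightarrow> real" where
  "tent m k t = max 0 (1 - real m * \<bar>t - k\<bar>)"

definition tent_mass :: "nat \<Rightarrow> (real \<Rightarrow> real measure) \<Rightarrow> real \<Rightarrow> real \<Rightarrow> real" where
  "tent_mass m \<nu> k x = (LINT t|\<nu> x. tent m k t)"

lemma tent_bounds: "0 \<le> tent m k t" "tent m k t \<le> 1"
  by (auto simp: tent_def)

lemma continuous_tent: "continuous_on UNIV (tent m k)"
  unfolding tent_def by (intro continuous_intros)

lemma bounded_tent: "bounded (range (tent m k))"
  using tent_bounds by (auto intro!: boundedI[of _ 1])

lemma measurable_tent [measurable]: "tent m k \<in> borel_measurable borel"
  by (rule borel_measurable_continuous_onI[OF continuous_tent])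

lemma tent_self [simp]: "tent m k k = 1"
  by (simp add: tent_def)

lemma eventually_tent_zero:
  assumes "j \<noteq> k"
  shows "eventually (\<lambda>m. tent m k j = 0) sequentially"
proof -
  obtain N where N: "1 / \<bar>j - k\<bar> < real N" using reals_Archimedean2 by blast
  have "tent m k j = 0" if "m \<ge> N" for m
  proof -
    have "1 / \<bar>j - k\<bar> < real m" using N that by linarith
    then have "1 < real m * \<bar>j - k\<bar>" using assms by (simp add: divide_less_eq split: if_splits)
    then show ?thesis by (simp add: tent_def)
  qed
  then show ?thesis by (auto simp: eventually_sequentially)
qed

lemma tent_tendsto: "(\<lambda>m. tent m k t) \<longlonglongrightarrow> indicator {k} t"
proof (cases "t = k")
  case False
  then show ?thesis using eventually_tent_zero[OF False] by (auto intro: tendsto_eventually)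
qed auto

text \<open>There are finitely many pairs of labels, so one sufficiently steep slope serves all of
  them; from then on a tent is indistinguishable from an indicator for measures carried by
  \<open>L\<close>.\<close>

lemma separating_tent:
  assumes "finite L"
  obtains m where "\<And>j k. j \<in> L \<Longrightarrow> k \<in> L \<Longrightarrow> tent m k j = indicator {k} j"
proof -
  have "eventually (\<lambda>m. \<forall>k\<in>L. \<forall>j\<in>L. tent m k j = indicator {k} j) sequentially"
  proof (intro eventually_ball_finite assms ballI)
    fix j k :: real
    show "eventually (\<lambda>m. tent m k j = indicator {k} j) sequentially"
      by (cases "j = k") (use eventually_tent_zero[of j k] in auto)
  qed
  then show ?thesis using that by (auto simp: eventually_sequentially)
qed

section \<open>Masses of points under a Young measure\<close>

lemma young_measureD:
  assumes "young_measure \<nu>" "x \<in> {0..1}"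
  shows "prob_space (\<nu> x)" "sets (\<nu> x) = sets borel" "space (\<nu> x) = UNIV"
  using assms sets_eq_imp_space_eq[of "\<nu> x" borel] by (auto simp: young_measure_def)

lemma tent_mass_measurable:
  assumes "young_measure \<nu>"
  shows "tent_mass m \<nu> k \<in> borel_measurable unit_leb"
  using assms continuous_tent bounded_tent unfolding young_measure_def tent_mass_def by blast

lemma integrable_tent:
  assumes "young_measure \<nu>" "x \<in> {0..1}"
  shows "integrable (\<nu> x) (tent m k)"
proof -
  interpret prob_space "\<nu> x" by (rule young_measureD(1)[OF assms])
  show ?thesis
    by (rule integrable_const_bound[where B = 1])
      (use tent_bounds young_measureD(2)[OF assms] in \<open>auto simp: measurable_cong_sets[OF young_measureD(2)[OF assms] refl]\<close>)
qed

lemma tent_mass_bounds: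
  assumes "young_measure \<nu>" "x \<in> {0..1}"
  shows "0 \<le> tent_mass m \<nu> k x" "tent_mass m \<nu> k x \<le> 1"
proof -
  interpret prob_space "\<nu> x" by (rule young_measureD(1)[OF assms])
  show "0 \<le> tent_mass m \<nu> k x" unfolding tent_mass_def by (intro integral_nonneg_AE AE_I2 tent_bounds)
  have "tent_mass m \<nu> k x \<le> (LINT t|\<nu> x. 1)"
    unfolding tent_mass_def using integrable_tent[OF assms] tent_bounds by (intro integral_mono) auto
  then show "tent_mass m \<nu> k x \<le> 1" by (simp add: prob_space)
qed

lemma mass_bounds:
  assumes "young_measure \<nu>" "x \<in> {0..1}"
  shows "0 \<le> mass \<nu> k x" "mass \<nu> k x \<le> 1"
  using prob_space.prob_le_1[OF young_measureD(1)[OF assms]] by (auto simp: mass_def)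

text \<open>Measurability in \<open>x\<close> is given for continuous test functions only; the mass
  of a point is the pointwise limit of tent masses as the slope grows.\<close>

lemma mass_measurable:
  assumes "young_measure \<nu>"
  shows "mass \<nu> k \<in> borel_measurable unit_leb"
proof (rule borel_measurable_LIMSEQ_real)
  show "tent_mass m \<nu> k \<in> borel_measurable unit_leb" for m
    by (rule tent_mass_measurable[OF assms])
  fix x assume "x \<in> space unit_leb"
  then have x: "x \<in> {0..1}" by simp
  interpret prob_space "\<nu> x" by (rule young_measureD(1)[OF assms x])
  note M = young_measureD(2,3)[OF assms x]
  have "(\<lambda>m. tent_mass m \<nu> k x) \<longlonglongrightarrow> (LINT t|\<nu> x. indicator {k} t)"
    unfolding tent_mass_def
  proof (rule integral_dominated_convergence[where w = "\<lambda>_. 1"])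
    show "AE t in \<nu> x. (\<lambda>m. tent m k t) \<longlonglongrightarrow> indicator {k} t"
      by (intro AE_I2 tent_tendsto)
    show "AE t in \<nu> x. norm (tent m k t) \<le> 1" for m
      using tent_bounds by (intro AE_I2) auto
  qed (auto simp: measurable_cong_sets[OF M(1) refl])
  then show "(\<lambda>m. tent_mass m \<nu> k x) \<longlonglongrightarrow> mass \<nu> k x"
    using M by (simp add: mass_def)
qed

section \<open>Integrals that reduce to finite sums over the labels\<close>

lemma sum_mult_indicator_singleton:
  fixes h :: "'a \<Rightarrow> real"
  assumes "finite L"
  shows "(\<Sum>k\<in>L. h k * indicator {k} b) = (if b \<in> L then h b else 0)"
proof -
  have "(\<Sum>k\<in>L. h k * indicator {k} b) = (\<Sum>k\<in>L. if k = b then h k else 0)"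
    by (intro sum.cong) (auto simp: indicator_def)
  then show ?thesis using assms by simp
qed

lemma integral_finite_support:
  fixes g :: "real \<Rightarrow> real"
  assumes "prob_space M" "sets M = sets borel" "finite L" "emeasure M (UNIV - L) = 0"
    and g: "g \<in> borel_measurable borel"
  shows "(LINT t|M. g t) = (\<Sum>k\<in>L. g k * measure M {k})"
proof -
  interpret prob_space M by fact
  have M: "space M = UNIV" using sets_eq_imp_space_eq[OF assms(2)] by simp
  have Ls: "UNIV - L \<in> sets M"
    unfolding assms(2) using assms(3) by (intro borel_open open_Diff finite_imp_closed) auto
  have "(LINT t|M. g t) = (LINT t|M. (\<Sum>k\<in>L. g k * indicator {k} t))"
  proof (rule integral_cong_AE)
    have "AE t in M. t \<notin> UNIV - L"
      using assms(4) Ls by (intro AE_not_in) (auto simp: null_sets_def)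
    then show "AE t in M. g t = (\<Sum>k\<in>L. g k * indicator {k} t)"
      by eventually_elim (simp only: sum_mult_indicator_singleton[OF assms(3)], simp)
  qed (use g in \<open>auto simp: measurable_cong_sets[OF assms(2) refl]\<close>)
  also have "\<dots> = (\<Sum>k\<in>L. g k * measure M {k})"
    using assms(2) M by (subst Bochner_Integration.integral_sum) (auto simp: less_top[symmetric])
  finally show ?thesis .
qed

lemma emeasure_return_outside:
  "finite L \<Longrightarrow> a \<in> L \<Longrightarrow> emeasure (return borel a) (UNIV - L) = (0 :: ennreal)" for a :: real
  by (subst emeasure_return) (auto intro!: borel_open open_Diff finite_imp_closed)

lemma label_class_n_imp_label_class:
  assumes "finite L" "label_class_n L n \<nu>"
  shows "label_class L \<nu>"
  using assms unfolding label_class_n_def label_class_def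
  by (intro AE_I2) (auto simp: emeasure_return_outside)

lemma tent_mass_eq_mass:
  assumes \<nu>: "young_measure \<nu>" "x \<in> {0..1}" and L: "finite L" "emeasure (\<nu> x) (UNIV - L) = 0"
    and m: "\<And>j k. j \<in> L \<Longrightarrow> k \<in> L \<Longrightarrow> tent m k j = indicator {k} j" and k: "k \<in> L"
  shows "tent_mass m \<nu> k x = mass \<nu> k x"
proof -
  have "tent_mass m \<nu> k x = (\<Sum>j\<in>L. tent m k j * measure (\<nu> x) {j})"
    unfolding tent_mass_def
    by (rule integral_finite_support[OF young_measureD(1,2)[OF \<nu>] L measurable_tent])
  also have "\<dots> = (\<Sum>j\<in>L. if j = k then measure (\<nu> x) {j} else 0)"
    using m k by (intro sum.cong) (auto simp: indicator_def)
  also have "\<dots> = mass \<nu> k x" using k L by (simp add: mass_def)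
  finally show ?thesis .
qed

text \<open>As \<open>fL\<close> vanishes once an argument leaves \<open>L\<close>, it is, in each
  argument, a finite combination of indicators of points, and this identity holds everywhere rather
  than almost everywhere.\<close>

lemma integral_fL:
  assumes \<nu>: "young_measure \<nu>" "y \<in> {0..1}" and L: "finite L"
  shows "(LINT b|\<nu> y. fL L f a b) = (\<Sum>l\<in>L. fL L f a l * mass \<nu> l y)"
    and "(LINT b|\<nu> y. fL L f b a) = (\<Sum>l\<in>L. fL L f l a * mass \<nu> l y)"
proof -
  interpret prob_space "\<nu> y" by (rule young_measureD(1)[OF \<nu>])
  note M = young_measureD(2,3)[OF \<nu>]
  have *: "(LINT b|\<nu> y. h b) = (\<Sum>l\<in>L. h l * mass \<nu> l y)" if h: "\<And>b. b \<notin> L \<Longrightarrow> h b = 0" for h :: "real \<Rightarrow> real"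
  proof -
    have "h b = (\<Sum>l\<in>L. h l * indicator {l} b)" for b
      unfolding sum_mult_indicator_singleton[OF L] using h[of b] by simp
    then have "(LINT b|\<nu> y. h b) = (LINT b|\<nu> y. (\<Sum>l\<in>L. h l * indicator {l} b))"
      by (rule Bochner_Integration.integral_cong[OF refl])
    also have "\<dots> = (\<Sum>l\<in>L. h l * mass \<nu> l y)"
      using M by (subst Bochner_Integration.integral_sum) (auto simp: less_top[symmetric] mass_def)
    finally show ?thesis .
  qed
  show "(LINT b|\<nu> y. fL L f a b) = (\<Sum>l\<in>L. fL L f a l * mass \<nu> l y)"
    and "(LINT b|\<nu> y. fL L f b a) = (\<Sum>l\<in>L. fL L f l a * mass \<nu> l y)"
    by (rule *, simp add: fL_def)+
qed

lemma double_integral_fL: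
  assumes \<nu>: "young_measure \<nu>" "x \<in> {0..1}" "y \<in> {0..1}" and L: "finite L"
  shows "(LINT a|\<nu> x. LINT b|\<nu> y. fL L f a b) = (\<Sum>k\<in>L. \<Sum>l\<in>L. f k l * (mass \<nu> k x * mass \<nu> l y))"
proof -
  interpret prob_space "\<nu> x" by (rule young_measureD(1)[OF \<nu>(1,2)])
  have i: "integrable (\<nu> x) (\<lambda>a. fL L f a l)" for l
  proof -
    have "(\<lambda>a. fL L f a l) = (\<lambda>a. \<Sum>k\<in>L. fL L f k l * indicator {k} a)"
    proof
      fix a show "fL L f a l = (\<Sum>k\<in>L. fL L f k l * indicator {k} a)"
        unfolding sum_mult_indicator_singleton[OF L] by (simp add: fL_def)
    qed
    moreover have "integrable (\<nu> x) (\<lambda>a. \<Sum>k\<in>L. fL L f k l * indicator {k} a)"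
      using young_measureD(2)[OF \<nu>(1,2)] by (auto simp: less_top[symmetric])
    ultimately show ?thesis by simp
  qed
  have "(LINT a|\<nu> x. LINT b|\<nu> y. fL L f a b) = (\<Sum>l\<in>L. (LINT a|\<nu> x. fL L f a l) * mass \<nu> l y)"
    using i by (simp add: integral_fL(1)[OF \<nu>(1,3) L])
  also have "\<dots> = (\<Sum>l\<in>L. \<Sum>k\<in>L. f k l * (mass \<nu> k x * mass \<nu> l y))"
    unfolding integral_fL(2)[OF \<nu>(1,2) L] sum_distrib_right
    by (intro sum.cong) (auto simp: fL_def)
  also have "\<dots> = (\<Sum>k\<in>L. \<Sum>l\<in>L. f k l * (mass \<nu> k x * mass \<nu> l y))"
    by (rule sum.swap)
  finally show ?thesis .
qed

lemma energy_eq_bil: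
  assumes \<nu>: "young_measure \<nu>" and L: "finite L"
    and U: "(\<lambda>p. U (fst p) (snd p)) \<in> borel_measurable square_leb"
      "\<And>x y. x \<in> {0..1} \<Longrightarrow> y \<in> {0..1} \<Longrightarrow> \<bar>U x y\<bar> \<le> 1"
  shows "energy L f U \<nu> = (\<Sum>k\<in>L. \<Sum>l\<in>L. f k l * bil U (mass \<nu> k) (mass \<nu> l))"
proof -
  have i: "integrable square_leb (\<lambda>p. U (fst p) (snd p) * (mass \<nu> k (fst p) * mass \<nu> l (snd p)))" for k l
    by (rule integrable_square_product[where W = U, OF U]) (use mass_measurable[OF \<nu>] mass_bounds[OF \<nu>] in auto)
  have "energy L f U \<nu> = (LINT p|square_leb. (\<Sum>k\<in>L. \<Sum>l\<in>L. f k l * (U (fst p) (snd p) * (mass \<nu> k (fst p) * mass \<nu> l (snd p)))))"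
    unfolding energy_def
    by (intro Bochner_Integration.integral_cong) (auto simp: double_integral_fL[OF \<nu> _ _ L] sum_distrib_left mult_ac)
  also have "\<dots> = (\<Sum>k\<in>L. \<Sum>l\<in>L. f k l * bil U (mass \<nu> k) (mass \<nu> l))"
    using i by (simp add: bil_def)
  finally show ?thesis .
qed

section \<open>Step graphons and the cut norm\<close>

lemma graphon_of_measurable: "(\<lambda>p. graphon_of A n (fst p) (snd p)) \<in> borel_measurable square_leb"
proof -
  have "(\<lambda>p. graphon_of A n (fst p) (snd p))
     = indicator (\<Union>i\<in>{1..n}. \<Union>j\<in>{j\<in>{1..n}. A n i j}. cellset n i \<times> cellset n j)"
  proof
    fix p
    have "(\<exists>i j. i \<in> {1..n} \<and> j \<in> {1..n} \<and> fst p \<in> cellset n i \<and> snd p \<in> cellset n j \<and> A n i j)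
      \<longleftrightarrow> p \<in> (\<Union>i\<in>{1..n}. \<Union>j\<in>{j\<in>{1..n}. A n i j}. cellset n i \<times> cellset n j)"
      by (simp only: UN_iff mem_Times_iff mem_Collect_eq) blast
    then show "graphon_of A n (fst p) (snd p)
      = indicator (\<Union>i\<in>{1..n}. \<Union>j\<in>{j\<in>{1..n}. A n i j}. cellset n i \<times> cellset n j) p"
      unfolding graphon_of_def by (simp only: indicator_def of_bool_def)
  qed
  moreover have "cellset n i \<in> sets borel" for i by (simp add: cellset_def)
  then have "(\<Union>i\<in>{1..n}. \<Union>j\<in>{j\<in>{1..n}. A n i j}. cellset n i \<times> cellset n j) \<in> sets borel"
    by (intro sets.finite_UN) (auto intro!: borel_Times)
  ultimately show ?thesis
    by (auto intro!: measurable_restrict_space1 measurable_completion)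
qed

lemma graphon_of_bounds: "0 \<le> graphon_of A n x y" "graphon_of A n x y \<le> 1"
  by (auto simp: graphon_of_def)

text \<open>The cut norm is a supremum of reals, so it dominates its members only once the set is
  known to be bounded above; the measure of the square is a bound.\<close>

lemma cut_norm_upper:
  assumes U: "\<And>x y. x \<in> {0..1} \<Longrightarrow> y \<in> {0..1} \<Longrightarrow> \<bar>U x y\<bar> \<le> 1"
    and ST: "S \<in> sets unit_leb" "T \<in> sets unit_leb"
  shows "\<bar>bil U (indicator S) (indicator T)\<bar> \<le> cut_norm U"
proof -
  let ?X = "{\<bar>LINT p | square_leb. indicator (S \<times> T) p * U (fst p) (snd p)\<bar> | S T.
       S \<in> sets unit_leb \<and> T \<in> sets unit_leb}"
  have "bdd_above ?X"
  proof (rule bdd_aboveI)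
    fix v assume "v \<in> ?X"
    then obtain S T :: "real set" where v: "v = \<bar>LINT p | square_leb. indicator (S \<times> T) p * U (fst p) (snd p)\<bar>" by blast
    show "v \<le> (LINT p|square_leb. 1)"
    proof (cases "integrable square_leb (\<lambda>p. indicator (S \<times> T) p * U (fst p) (snd p))")
      case True
      have "v \<le> (LINT p|square_leb. \<bar>indicator (S \<times> T) p * U (fst p) (snd p)\<bar>)"
        unfolding v by (rule integral_abs_bound)
      also have "\<dots> \<le> (LINT p|square_leb. 1)"
        using True U by (intro integral_mono integrable_abs) (auto split: split_indicator)
      finally show ?thesis .
    next
      case False
      \<comment> \<open>The integral of a non-integrable function is 0 by convention, so the bound
        persists.\<close>
      then show ?thesis unfolding v by (simp add: not_integrable_integral_eq)
    qed
  qed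
  moreover have "bil U (indicator S) (indicator T) = (LINT p | square_leb. indicator (S \<times> T) p * U (fst p) (snd p))"
    unfolding bil_def by (intro Bochner_Integration.integral_cong) (auto split: split_indicator)
  ultimately show ?thesis unfolding cut_norm_def using ST by (intro cSup_upper) auto
qed

section \<open>Narrow continuity and comparison of the energies\<close>

lemma narrow_conv_tent_mass:
  assumes "narrow_conv \<nu>s \<nu>"
  shows "weakly_converges (\<lambda>n. tent_mass m (\<nu>s n) k) (tent_mass m \<nu> k)"
  unfolding weakly_converges_def tent_mass_def
  using assms[unfolded narrow_conv_def, rule_format, OF conjI[OF continuous_tent bounded_tent]] by simp

lemma graphon0D:
  assumes "graphon0 W"
  shows "(\<lambda>p. W (fst p) (snd p)) \<in> borel_measurable square_leb"
    "\<And>x y. x \<in> {0..1} \<Longrightarrow> y \<in> {0..1} \<Longrightarrow> \<bar>W x y\<bar> \<le> 1"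
    "\<And>x y. x \<in> {0..1} \<Longrightarrow> y \<in> {0..1} \<Longrightarrow> 0 \<le> W x y \<and> W x y \<le> 1"
  using assms unfolding graphon0_def by auto

text \<open>A surrogate for the energy that is narrowly continuous along arbitrary Young measures;
  with a separating slope it agrees with the energy on those carried by \<open>L\<close>.\<close>

definition tent_energy :: "nat \<Rightarrow> real set \<Rightarrow> (real \<Rightarrow> real \<Rightarrow> real) \<Rightarrow> (real \<Rightarrow> real \<Rightarrow> real)
    \<Rightarrow> (real \<Rightarrow> real measure) \<Rightarrow> real" where
  "tent_energy m L f W \<nu> = (\<Sum>k\<in>L. \<Sum>l\<in>L. f k l * bil W (tent_mass m \<nu> k) (tent_mass m \<nu> l))"

lemma tent_energy_tendsto:
  assumes W: "graphon0 W" and \<nu>s: "\<And>n. young_measure (\<nu>s n)" and \<nu>: "young_measure \<nu>" and nc: "narrow_conv \<nu>s \<nu>"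
  shows "(\<lambda>n. tent_energy m L f W (\<nu>s n)) \<longlonglongrightarrow> tent_energy m L f W \<nu>"
  unfolding tent_energy_def
proof (intro tendsto_sum tendsto_mult tendsto_const)
  fix k l
  obtain K where K: "K \<in> borel_measurable borel" "\<And>p. \<bar>K p\<bar> \<le> 1"
    "AE p in lebesgue. indicator unit_sq p * W (fst p) (snd p) = K p"
    using borel_kernel_version[where W = W, OF graphon0D(1,2)[OF W]] by blast
  have bil: "bil W (tent_mass m \<mu> k) (tent_mass m \<mu> l)
      = (LINT x|unit_leb. tent_mass m \<mu> k x * (LINT y|unit_leb. K (x, y) * tent_mass m \<mu> l y))"
    if "young_measure \<mu>" for \<mu>
    unfolding bil_def
    by (rule integral_square_iterated[where W = W, OF graphon0D(1,2)[OF W] K(1,3)])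
      (use tent_mass_measurable[OF that] tent_mass_bounds[OF that] in auto)
  have "(\<lambda>n. LINT x|unit_leb. tent_mass m (\<nu>s n) k x * (LINT y|unit_leb. K (x, y) * tent_mass m (\<nu>s n) l y))
     \<longlonglongrightarrow> (LINT x|unit_leb. tent_mass m \<nu> k x * (LINT y|unit_leb. K (x, y) * tent_mass m \<nu> l y))"
    by (rule weakly_converges_bilinear[OF K(1,2) _ _ _ _ _ _ narrow_conv_tent_mass[OF nc] narrow_conv_tent_mass[OF nc]])
      (use tent_mass_measurable \<nu>s \<nu> tent_mass_bounds in auto)
  then show "(\<lambda>n. bil W (tent_mass m (\<nu>s n) k) (tent_mass m (\<nu>s n) l)) \<longlonglongrightarrow> bil W (tent_mass m \<nu> k) (tent_mass m \<nu> l)"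
    by (simp add: bil \<nu> \<nu>s)
qed

text \<open>For almost every \<open>x\<close> the measure lives on \<open>L\<close>, where a
  separating tent is the indicator of its label. Exceptional null sets on the line become null
  strips in the square, so the integrals agree.\<close>

lemma energy_eq_tent_energy:
  assumes W: "graphon0 W" and \<nu>: "young_measure \<nu>" and L: "finite L" and lc: "label_class L \<nu>"
    and m: "\<And>j k. j \<in> L \<Longrightarrow> k \<in> L \<Longrightarrow> tent m k j = indicator {k} j"
  shows "energy L f W \<nu> = tent_energy m L f W \<nu>"
proof -
  have AE_eq: "AE x in lebesgue. x \<in> {0..1} \<longrightarrow> tent_mass m \<nu> k x = mass \<nu> k x" if k: "k \<in> L" for k
  proof -
    have "AE x in lebesgue. x \<in> {0..1} \<longrightarrow> emeasure (\<nu> x) (UNIV - L) = 0"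
      using lc unfolding label_class_def by (simp add: AE_restrict_space_iff)
    then show ?thesis
      by eventually_elim (use tent_mass_eq_mass[OF \<nu> _ L _ m k] in blast)
  qed
  have "bil W (mass \<nu> k) (mass \<nu> l) = bil W (tent_mass m \<nu> k) (tent_mass m \<nu> l)" if kl: "k \<in> L" "l \<in> L" for k l
    unfolding bil_def
  proof (rule integral_cong_AE)
    show "(\<lambda>p. W (fst p) (snd p) * (mass \<nu> k (fst p) * mass \<nu> l (snd p))) \<in> borel_measurable square_leb"
      by (rule borel_measurable_integrable, rule integrable_square_product[where W = W, OF graphon0D(1,2)[OF W]])
        (use mass_measurable[OF \<nu>] mass_bounds[OF \<nu>] in auto)
    show "(\<lambda>p. W (fst p) (snd p) * (tent_mass m \<nu> k (fst p) * tent_mass m \<nu> l (snd p))) \<in> borel_measurable square_leb"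
      by (rule borel_measurable_integrable, rule integrable_square_product[where W = W, OF graphon0D(1,2)[OF W]])
        (use tent_mass_measurable[OF \<nu>] tent_mass_bounds[OF \<nu>] in auto)
    have "AE p in lebesgue. p \<in> unit_sq \<longrightarrow> W (fst p) (snd p) * (mass \<nu> k (fst p) * mass \<nu> l (snd p))
        = W (fst p) (snd p) * (tent_mass m \<nu> k (fst p) * tent_mass m \<nu> l (snd p))"
      using AE_lebesgue_fst[OF AE_eq[OF kl(1)]] AE_lebesgue_snd[OF AE_eq[OF kl(2)]]
      by eventually_elim auto
    then show "AE p in square_leb. W (fst p) (snd p) * (mass \<nu> k (fst p) * mass \<nu> l (snd p))
        = W (fst p) (snd p) * (tent_mass m \<nu> k (fst p) * tent_mass m \<nu> l (snd p))"
      by (subst AE_restrict_space_iff) auto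
  qed
  moreover have "energy L f W \<nu> = (\<Sum>k\<in>L. \<Sum>l\<in>L. f k l * bil W (mass \<nu> k) (mass \<nu> l))"
    by (rule energy_eq_bil[OF \<nu> L]) (use graphon0D[OF W] in auto)
  ultimately show ?thesis
    unfolding tent_energy_def by simp
qed

text \<open>The masses of a labelling are indicators of the level sets \<open>S k\<close>, so each
  term of the energy difference integrates \<open>G - W\<close> over a rectangle of measurable sets,
  precisely what the cut norm controls.\<close>

lemma label_class_n_energy_bound:
  assumes W: "graphon0 W" and \<nu>: "young_measure \<nu>" and L: "finite L" and lc: "label_class_n L n \<nu>"
    and m: "\<And>j k. j \<in> L \<Longrightarrow> k \<in> L \<Longrightarrow> tent m k j = indicator {k} j"
  shows "\<bar>energy L f (graphon_of A n) \<nu> - tent_energy m L f W \<nu>\<bar>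
    \<le> (\<Sum>k\<in>L. \<Sum>l\<in>L. \<bar>f k l\<bar>) * cut_norm (\<lambda>x y. graphon_of A n x y - W x y)"
proof -
  define G where "G = graphon_of A n"
  obtain u where u: "u \<in> borel_measurable unit_leb" "\<And>x. x \<in> {0..1} \<Longrightarrow> u x \<in> L"
    "\<And>x. x \<in> {0..1} \<Longrightarrow> \<nu> x = return borel (u x)"
    using lc unfolding label_class_n_def by auto
  define S where "S k = {x\<in>{0..1}. u x = k}" for k
  have S: "S k \<in> sets unit_leb" for k
    using measurable_sets[OF u(1), of "{k}"] by (auto simp: S_def vimage_def Int_def conj_commute)
  have mass: "mass \<nu> k x = indicator (S k) x" if "x \<in> {0..1}" for k x
    using that u(3)[OF that] by (auto simp: mass_def S_def measure_return indicator_def)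
  have G: "(\<lambda>p. G (fst p) (snd p)) \<in> borel_measurable square_leb"
     "\<And>x y. x \<in> {0..1} \<Longrightarrow> y \<in> {0..1} \<Longrightarrow> \<bar>G x y\<bar> \<le> 1"
    using graphon_of_measurable graphon_of_bounds[of A n] by (auto simp: G_def)
  \<comment> \<open>Both kernels take values in [0, 1], so their difference keeps the bound 1
    instead of 2.\<close>
  have GW: "\<bar>G x y - W x y\<bar> \<le> 1" if "x \<in> {0..1}" "y \<in> {0..1}" for x y
    using graphon_of_bounds[of A n x y] graphon0D(3)[OF W that] unfolding G_def by (auto simp: abs_le_iff)
  have diff: "\<bar>bil G (mass \<nu> k) (mass \<nu> l) - bil W (mass \<nu> k) (mass \<nu> l)\<bar>
     \<le> cut_norm (\<lambda>x y. G x y - W x y)" for k l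
  proof -
    have i: "integrable square_leb (\<lambda>p. U (fst p) (snd p) * (mass \<nu> k (fst p) * mass \<nu> l (snd p)))"
      if "(\<lambda>p. U (fst p) (snd p)) \<in> borel_measurable square_leb"
        "\<And>x y. x \<in> {0..1} \<Longrightarrow> y \<in> {0..1} \<Longrightarrow> \<bar>U x y\<bar> \<le> 1" for U
      by (rule integrable_square_product[where W = U, OF that]) (use mass_measurable[OF \<nu>] mass_bounds[OF \<nu>] in auto)
    have "bil G (mass \<nu> k) (mass \<nu> l) - bil W (mass \<nu> k) (mass \<nu> l)
       = (LINT p|square_leb. G (fst p) (snd p) * (mass \<nu> k (fst p) * mass \<nu> l (snd p)) - W (fst p) (snd p) * (mass \<nu> k (fst p) * mass \<nu> l (snd p)))"
      unfolding bil_def by (rule Bochner_Integration.integral_diff[symmetric, OF i[where U = G, OF G] i[where U = W, OF graphon0D(1,2)[OF W]]])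
    also have "\<dots> = bil (\<lambda>x y. G x y - W x y) (indicator (S k)) (indicator (S l))"
      unfolding bil_def by (intro Bochner_Integration.integral_cong) (auto simp: mass algebra_simps)
    finally show ?thesis
      using cut_norm_upper[OF GW S S] by simp
  qed
  have tent: "tent_energy m L f W \<nu> = energy L f W \<nu>"
    using energy_eq_tent_energy[OF W \<nu> L label_class_n_imp_label_class[OF L lc] m] by simp
  have "energy L f G \<nu> - energy L f W \<nu>
     = (\<Sum>k\<in>L. \<Sum>l\<in>L. f k l * (bil G (mass \<nu> k) (mass \<nu> l) - bil W (mass \<nu> k) (mass \<nu> l)))"
  proof -
    have "energy L f W \<nu> = (\<Sum>k\<in>L. \<Sum>l\<in>L. f k l * bil W (mass \<nu> k) (mass \<nu> l))"
      by (rule energy_eq_bil[OF \<nu> L]) (use graphon0D[OF W] in auto)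
    moreover have "energy L f G \<nu> = (\<Sum>k\<in>L. \<Sum>l\<in>L. f k l * bil G (mass \<nu> k) (mass \<nu> l))"
      by (rule energy_eq_bil[OF \<nu> L]) (use G in auto)
    ultimately show ?thesis by (simp add: sum_subtractf right_diff_distrib)
  qed
  moreover have "\<bar>\<Sum>k\<in>L. \<Sum>l\<in>L. f k l * (bil G (mass \<nu> k) (mass \<nu> l) - bil W (mass \<nu> k) (mass \<nu> l))\<bar>
     \<le> (\<Sum>k\<in>L. \<Sum>l\<in>L. \<bar>f k l\<bar> * cut_norm (\<lambda>x y. G x y - W x y))"
    by (intro order_trans[OF sum_abs] sum_mono) (auto simp: abs_mult intro!: mult_left_mono diff)
  ultimately show ?thesis unfolding tent sum_distrib_right G_def by simp
qed

section \<open>Gamma-convergence\<close>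

lemma integral_return_borel:
  fixes g :: "real \<Rightarrow> real"
  assumes "g \<in> borel_measurable borel"
  shows "(LINT t|return borel a. g t) = g a"
  using assms by (intro integral_return) auto

text \<open>The mean \<open>c\<close> of a test function vanishing exactly on \<open>L\<close> is
  zero for labellings and nonzero for \<nu>. Since \<open>c\<close> is narrowly continuous, only
  finitely many members of the sequence can be labellings.\<close>

lemma eventually_not_label_class_n:
  assumes L: "finite L" and \<nu>s: "\<And>n. young_measure (\<nu>s n)" and \<nu>: "young_measure \<nu>"
    and nc: "narrow_conv \<nu>s \<nu>" and nl: "\<not> label_class L \<nu>"
  shows "eventually (\<lambda>n. \<not> label_class_n L n (\<nu>s n)) sequentially"
proof -
  \<comment> \<open>Cutting each distance at 1 keeps the product bounded without changing its
    zeros.\<close>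
  define g where "g t = (\<Prod>l\<in>L. min 1 \<bar>t - l\<bar>)" for t :: real
  have g0: "g t = 0 \<longleftrightarrow> t \<in> L" for t
  proof -
    have "min 1 \<bar>t - l\<bar> = 0 \<longleftrightarrow> t = l" for l by linarith
    then show ?thesis using L unfolding g_def by auto
  qed
  have gnn: "0 \<le> g t" for t unfolding g_def by (intro prod_nonneg) auto
  have g1: "g t \<le> 1" for t unfolding g_def by (intro prod_le_1) auto
  have gc: "continuous_on UNIV g" unfolding g_def by (intro continuous_intros)
  have gb: "bounded (range g)" using gnn g1 by (auto intro!: boundedI[of _ 1])
  have gm [measurable]: "g \<in> borel_measurable borel" by (rule borel_measurable_continuous_onI[OF gc])
  define c where "c \<mu> = (LINT x|unit_leb. (LINT t|\<mu> x. g t))" for \<mu> :: "real \<Rightarrow> real measure"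
  have lim: "(\<lambda>n. c (\<nu>s n)) \<longlonglongrightarrow> c \<nu>"
    using nc[unfolded narrow_conv_def, rule_format, of g "\<lambda>_. 1"] gc gb by (simp add: c_def)
  have nn: "0 \<le> (LINT t|\<mu>. g t)" for \<mu> by (intro integral_nonneg_AE AE_I2 gnn)
  have ig: "integrable (\<nu> x) g" if x: "x \<in> {0..1}" for x
  proof -
    interpret prob_space "\<nu> x" by (rule young_measureD(1)[OF \<nu> x])
    show ?thesis
      by (rule integrable_const_bound[where B = 1])
        (use gnn g1 in \<open>auto simp: measurable_cong_sets[OF young_measureD(2)[OF \<nu> x] refl]\<close>)
  qed
  \<comment> \<open>Otherwise, \<open>g\<close> being nonnegative, its integral vanishes for almost
    every \<open>x\<close>, hence \<open>g = 0\<close> almost surely under \<nu> at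
    \<open>x\<close>, which puts all mass on \<open>L\<close>.\<close>
  have "c \<nu> \<noteq> 0"
  proof
    assume c0: "c \<nu> = 0"
    have "integrable unit_leb (\<lambda>x. LINT t|\<nu> x. g t)"
    proof (rule unit_leb.integrable_const_bound[where B = 1])
      show "(\<lambda>x. LINT t|\<nu> x. g t) \<in> borel_measurable unit_leb"
        using \<nu> gc gb unfolding young_measure_def by blast
      show "AE x in unit_leb. norm (LINT t|\<nu> x. g t) \<le> 1"
      proof (rule AE_I2)
        fix x assume "x \<in> space unit_leb"
        then have x: "x \<in> {0..1}" by simp
        interpret prob_space "\<nu> x" by (rule young_measureD(1)[OF \<nu> x])
        have "(LINT t|\<nu> x. g t) \<le> (LINT t|\<nu> x. 1)"
          using ig[OF x] g1 by (intro integral_mono) auto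
        then show "norm (LINT t|\<nu> x. g t) \<le> 1" using nn[of "\<nu> x"] by (simp add: prob_space)
      qed
    qed
    then have "AE x in unit_leb. (LINT t|\<nu> x. g t) = 0"
      using c0 integral_nonneg_eq_0_iff_AE[of unit_leb "\<lambda>x. LINT t|\<nu> x. g t"] nn by (auto simp: c_def)
    then have "label_class L \<nu>"
      unfolding label_class_def
    proof (rule AE_mp, intro AE_I2 impI)
      fix x assume "x \<in> space unit_leb" and z: "(LINT t|\<nu> x. g t) = 0"
      then have x: "x \<in> {0..1}" by simp
      note M = young_measureD(2,3)[OF \<nu> x]
      have "AE t in \<nu> x. g t = 0"
        using z integral_nonneg_eq_0_iff_AE[OF ig[OF x]] gnn by auto
      then have "AE t in \<nu> x. t \<notin> UNIV - L" using g0 by auto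
      moreover have "UNIV - L \<in> sets (\<nu> x)"
        unfolding M using L by (intro borel_open open_Diff finite_imp_closed) auto
      ultimately show "emeasure (\<nu> x) (UNIV - L) = 0"
        using AE_iff_null_sets[of "UNIV - L" "\<nu> x"] by (auto simp: null_sets_def)
    qed
    then show False using nl by simp
  qed
  then have "eventually (\<lambda>n. c (\<nu>s n) \<noteq> 0) sequentially"
    by (rule tendsto_imp_eventually_ne[OF lim])
  moreover have "c \<mu> = 0" if lc: "label_class_n L n \<mu>" for n \<mu>
  proof -
    obtain u where u: "\<And>x. x \<in> {0..1} \<Longrightarrow> u x \<in> L" "\<And>x. x \<in> {0..1} \<Longrightarrow> \<mu> x = return borel (u x)"
      using lc unfolding label_class_n_def by blast
    have "c \<mu> = (LINT x|unit_leb. 0)"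
      unfolding c_def by (intro Bochner_Integration.integral_cong) (auto simp: u integral_return_borel g0)
    then show ?thesis by simp
  qed
  ultimately show ?thesis by (auto elim: eventually_mono)
qed

text \<open>Cells are counted from 1 in \<open>cellset\<close> and from 0 in the labelling. The
  first cell is closed and contains 0, where the ceiling is 0; truncated subtraction still yields
  index 0.\<close>

lemma cell_index:
  assumes "i \<in> {1..n}" "x \<in> cellset n i"
  shows "nat \<lceil>real n * x\<rceil> - 1 = i - 1"
proof (cases "i = 1")
  case True
  then have "real n * x \<le> 1" using assms by (auto simp: cellset_def field_simps)
  then have "\<lceil>real n * x\<rceil> \<le> 1" by linarith
  then show ?thesis using True by linarith
next
  case False
  then show ?thesis using assms by (intro ceiling_cell) (auto simp: cellset_def)
qed

text \<open>Take Dirac measures at the greedy labelling of the masses of \<nu>. Integrals of a test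
  function become finite combinations of label indicators with coefficients \<open>g k\<close>, so
  weak convergence for each label is narrow convergence.\<close>

lemma exists_recovery_sequence:
  assumes L: "finite L" and \<nu>: "young_measure \<nu>" and lc: "label_class L \<nu>"
  obtains \<nu>s where "\<And>n. young_measure (\<nu>s n)" "\<And>n. label_class_n L n (\<nu>s n)" "narrow_conv \<nu>s \<nu>"
proof -
  have rep: "AE x in unit_leb. (LINT t|\<nu> x. g t) = (\<Sum>k\<in>L. g k * mass \<nu> k x)"
    if "g \<in> borel_measurable borel" for g :: "real \<Rightarrow> real"
    using lc[unfolded label_class_def] AE_space
  proof eventually_elim
    case (elim x)
    then show ?case
      unfolding mass_def by (intro integral_finite_support young_measureD[OF \<nu>] L that) auto
  qed
  \<comment> \<open>The representation with the constant test function 1 says that the masses of the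
    labels add up to the total mass of a probability measure.\<close>
  have sum1: "AE x in unit_leb. (\<Sum>k\<in>L. mass \<nu> k x) = 1"
    using rep[of "\<lambda>_. 1", OF borel_measurable_const] AE_space
  proof eventually_elim
    case (elim x)
    interpret prob_space "\<nu> x" by (rule young_measureD(1)[OF \<nu>]) (use elim in simp)
    show ?case using elim by (simp add: prob_space)
  qed
  obtain w where w: "\<And>n i. w n i \<in> L"
    "\<And>k. k \<in> L \<Longrightarrow> weakly_converges (\<lambda>n x. indicator {k} (w n (nat \<lceil>real n * x\<rceil> - 1))) (mass \<nu> k)"
    using exists_weakly_converging_labelling[OF L mass_measurable[OF \<nu>] _ sum1] mass_bounds[OF \<nu>] by blast
  define u where "u n x = w n (nat \<lceil>real n * x\<rceil> - 1)" for n and x :: real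
  have um [measurable]: "u n \<in> borel_measurable unit_leb" for n
    unfolding u_def by (intro measurable_restrict_space1 measurable_completion) simp
  have uL: "u n x \<in> L" for n x unfolding u_def by (rule w(1))
  define \<nu>s where "\<nu>s n x = return borel (u n x)" for n x
  have "young_measure (\<nu>s n)" for n
    unfolding young_measure_def
  proof (intro conjI ballI allI impI)
    fix g :: "real \<Rightarrow> real" assume "continuous_on UNIV g \<and> bounded (range g)"
    then have [measurable]: "g \<in> borel_measurable borel" using borel_measurable_continuous_onI by blast
    show "(\<lambda>x. LINT t|\<nu>s n x. g t) \<in> borel_measurable unit_leb"
      by (simp add: \<nu>s_def integral_return_borel)
  qed (auto simp: \<nu>s_def intro: prob_space_return)
  moreover have "label_class_n L n (\<nu>s n)" for n
    unfolding label_class_n_def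
  proof (intro exI[of _ "u n"] conjI ballI)
    fix i x y assume "i \<in> {1..n}" "x \<in> cellset n i" "y \<in> cellset n i"
    then show "u n x = u n y" unfolding u_def by (simp only: cell_index)
  qed (auto simp: uL \<nu>s_def)
  moreover have "narrow_conv \<nu>s \<nu>"
    unfolding narrow_conv_def
  proof (intro allI impI)
    fix g \<phi> :: "real \<Rightarrow> real" assume g: "continuous_on UNIV g \<and> bounded (range g)" and \<phi>: "integrable unit_leb \<phi>"
    have gm [measurable]: "g \<in> borel_measurable borel" using g borel_measurable_continuous_onI by blast
    have im: "integrable unit_leb (\<lambda>x. \<phi> x * mass \<nu> k x)" for k
      by (rule integrable_mult_bounded[OF \<phi> mass_measurable[OF \<nu>]]) (use mass_bounds[OF \<nu>] in auto)
    have iu: "integrable unit_leb (\<lambda>x. \<phi> x * indicator {k} (u n x))" for k n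
      by (rule integrable_mult_bounded[OF \<phi> measurable_compose[OF um borel_measurable_indicator]]) auto
    have "(LINT x|unit_leb. \<phi> x * (LINT t|\<nu>s n x. g t)) = (\<Sum>k\<in>L. g k * (LINT x|unit_leb. \<phi> x * indicator {k} (u n x)))" for n
    proof -
      have "g (u n x) = (\<Sum>k\<in>L. g k * indicator {k} (u n x))" for x
        unfolding sum_mult_indicator_singleton[OF L] using uL by simp
      then have "(LINT x|unit_leb. \<phi> x * (LINT t|\<nu>s n x. g t)) = (LINT x|unit_leb. (\<Sum>k\<in>L. g k * (\<phi> x * indicator {k} (u n x))))"
        by (simp only: \<nu>s_def integral_return_borel[OF gm] sum_distrib_left mult.left_commute)
      also have "\<dots> = (\<Sum>k\<in>L. LINT x|unit_leb. g k * (\<phi> x * indicator {k} (u n x)))"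
        by (rule Bochner_Integration.integral_sum) (rule integrable_mult_right[OF iu])
      finally show ?thesis by (simp only: integral_mult_right_zero)
    qed
    moreover have "(LINT x|unit_leb. \<phi> x * (LINT t|\<nu> x. g t)) = (\<Sum>k\<in>L. g k * (LINT x|unit_leb. \<phi> x * mass \<nu> k x))"
    proof -
      have "(LINT x|unit_leb. \<phi> x * (LINT t|\<nu> x. g t)) = (LINT x|unit_leb. (\<Sum>k\<in>L. g k * (\<phi> x * mass \<nu> k x)))"
      proof (rule integral_cong_AE)
        have "(\<lambda>x. LINT t|\<nu> x. g t) \<in> borel_measurable unit_leb"
          using \<nu> g unfolding young_measure_def by blast
        then show "(\<lambda>x. \<phi> x * (LINT t|\<nu> x. g t)) \<in> borel_measurable unit_leb"
          using \<phi> by measurable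
        show "(\<lambda>x. \<Sum>k\<in>L. g k * (\<phi> x * mass \<nu> k x)) \<in> borel_measurable unit_leb"
          using borel_measurable_integrable[OF \<phi>] mass_measurable[OF \<nu>]
          by (intro borel_measurable_sum borel_measurable_times) auto
        show "AE x in unit_leb. \<phi> x * (LINT t|\<nu> x. g t) = (\<Sum>k\<in>L. g k * (\<phi> x * mass \<nu> k x))"
          using rep[OF gm] by eventually_elim (simp add: sum_distrib_left mult.left_commute)
      qed
      then show ?thesis using im by simp
    qed
    moreover have "(\<lambda>n. \<Sum>k\<in>L. g k * (LINT x|unit_leb. \<phi> x * indicator {k} (u n x)))
       \<longlonglongrightarrow> (\<Sum>k\<in>L. g k * (LINT x|unit_leb. \<phi> x * mass \<nu> k x))"
      using w(2) \<phi> unfolding weakly_converges_def u_def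
      by (intro tendsto_sum tendsto_mult tendsto_const) blast
    ultimately show "(\<lambda>n. LINT x|unit_leb. \<phi> x * (LINT t|\<nu>s n x. g t)) \<longlonglongrightarrow> (LINT x|unit_leb. \<phi> x * (LINT t|\<nu> x. g t))"
      by simp
  qed
  ultimately show ?thesis using that by blast
qed

theorem theorem12:
  fixes A :: "nat \<Rightarrow> nat \<Rightarrow> nat \<Rightarrow> bool"
    and W :: "real \<Rightarrow> real \<Rightarrow> real"
    and L :: "real set"
    and f :: "real \<Rightarrow> real \<Rightarrow> real"
    and \<nu> :: "real \<Rightarrow> real measure"
  assumes "dense_graph_seq A"
    and "graphon0 W"
    and "(\<lambda>n. cut_norm (\<lambda>x y. graphon_of A n x y - W x y)) \<longlonglongrightarrow> 0"
    and "finite L"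
    and "young_measure \<nu>"
  shows "(\<forall>\<nu>s. (\<forall>n. young_measure (\<nu>s n)) \<and> narrow_conv \<nu>s \<nu> \<longrightarrow>
            I_lim L f W \<nu> \<le> liminf (\<lambda>n. I_n L f A n (\<nu>s n)))
       \<and> (\<exists>\<nu>s. (\<forall>n. young_measure (\<nu>s n)) \<and> narrow_conv \<nu>s \<nu> \<and>
            limsup (\<lambda>n. I_n L f A n (\<nu>s n)) = I_lim L f W \<nu>)"
proof -
  note W = assms(2) and cut = assms(3) and L = assms(4) and \<nu> = assms(5)
  obtain m where m: "\<And>j k. j \<in> L \<Longrightarrow> k \<in> L \<Longrightarrow> tent m k j = indicator {k} j"
    using separating_tent[OF L] by blast
  define err where "err n = (\<Sum>k\<in>L. \<Sum>l\<in>L. \<bar>f k l\<bar>) * cut_norm (\<lambda>x y. graphon_of A n x y - W x y)" for n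
  have err: "err \<longlonglongrightarrow> 0" unfolding err_def using tendsto_mult_right_zero[OF cut] by simp
  have near: "\<bar>energy L f (graphon_of A n) \<mu> - tent_energy m L f W \<mu>\<bar> \<le> err n"
    if "young_measure \<mu>" "label_class_n L n \<mu>" for n \<mu>
    unfolding err_def using label_class_n_energy_bound[OF W that(1) L that(2) m] by simp
  have lower: "I_lim L f W \<nu> \<le> liminf (\<lambda>n. I_n L f A n (\<nu>s n))"
    if \<nu>s: "\<And>n. young_measure (\<nu>s n)" and nc: "narrow_conv \<nu>s \<nu>" for \<nu>s
  proof (cases "label_class L \<nu>")
    case True
    \<comment> \<open>This converging sequence is a minorant of \<open>I_n\<close> for every
      \<open>n\<close>: by \<open>near\<close> when the measure is a labelling, and trivially
      otherwise, as \<open>I_n\<close> is then infinite.\<close>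
    have "(\<lambda>n. tent_energy m L f W (\<nu>s n) - err n) \<longlonglongrightarrow> tent_energy m L f W \<nu> - 0"
      by (intro tendsto_diff tent_energy_tendsto W \<nu>s \<nu> nc err)
    then have "(\<lambda>n. ereal (tent_energy m L f W (\<nu>s n) - err n)) \<longlonglongrightarrow> ereal (energy L f W \<nu>)"
      using energy_eq_tent_energy[OF W \<nu> L True m] by simp
    then have "I_lim L f W \<nu> = liminf (\<lambda>n. ereal (tent_energy m L f W (\<nu>s n) - err n))"
      using True by (subst lim_imp_Liminf[of sequentially _ "ereal (energy L f W \<nu>)"]) (simp_all add: I_lim_def)
    also have "\<dots> \<le> liminf (\<lambda>n. I_n L f A n (\<nu>s n))"
    proof (intro Liminf_mono always_eventually allI)
      fix n
      show "ereal (tent_energy m L f W (\<nu>s n) - err n) \<le> I_n L f A n (\<nu>s n)"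
        using near[OF \<nu>s, of n n] by (cases "label_class_n L n (\<nu>s n)") (auto simp: I_n_def)
    qed
    finally show ?thesis .
  next
    case False
    have "eventually (\<lambda>n. I_n L f A n (\<nu>s n) = \<infinity>) sequentially"
      using eventually_not_label_class_n[OF L \<nu>s \<nu> nc False]
      by eventually_elim (simp add: I_n_def)
    then have "liminf (\<lambda>n. I_n L f A n (\<nu>s n)) = \<infinity>"
      by (intro lim_imp_Liminf tendsto_eventually) simp_all
    then show ?thesis by simp
  qed
  moreover have "\<exists>\<nu>s. (\<forall>n. young_measure (\<nu>s n)) \<and> narrow_conv \<nu>s \<nu> \<and>
            limsup (\<lambda>n. I_n L f A n (\<nu>s n)) = I_lim L f W \<nu>"
  proof (cases "label_class L \<nu>")
    case True
    obtain \<nu>s where \<nu>s: "\<And>n. young_measure (\<nu>s n)" "\<And>n. label_class_n L n (\<nu>s n)" "narrow_conv \<nu>s \<nu>"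
      using exists_recovery_sequence[OF L \<nu> True] by blast
    \<comment> \<open>All members are labellings, so the cut norm estimate is available in both
      directions and the energies converge to a genuine limit.\<close>
    have "(\<lambda>n. energy L f (graphon_of A n) (\<nu>s n) - tent_energy m L f W (\<nu>s n)) \<longlonglongrightarrow> 0"
      by (rule Lim_null_comparison[OF _ err]) (use near[OF \<nu>s(1,2)] in simp)
    from tendsto_add[OF this tent_energy_tendsto[OF W \<nu>s(1) \<nu> \<nu>s(3), where m = m and L = L and f = f]]
    have "(\<lambda>n. energy L f (graphon_of A n) (\<nu>s n)) \<longlonglongrightarrow> energy L f W \<nu>"
      using energy_eq_tent_energy[OF W \<nu> L True m] by simp
    then have "limsup (\<lambda>n. I_n L f A n (\<nu>s n)) = I_lim L f W \<nu>"
      using \<nu>s(2) True by (intro lim_imp_Limsup) (simp_all add: I_n_def I_lim_def)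
    then show ?thesis using \<nu>s by blast
  next
    case False
    \<comment> \<open>When the target value is infinite the constant sequence recovers it: by the
      lower bound just shown its liminf is infinite, hence so is its limsup.\<close>
    have nc: "narrow_conv (\<lambda>_. \<nu>) \<nu>" by (simp add: narrow_conv_def)
    have "\<infinity> \<le> limsup (\<lambda>n. I_n L f A n \<nu>)"
      using lower[OF \<nu> nc] False Liminf_le_Limsup[of sequentially "\<lambda>n. I_n L f A n \<nu>"]
      by (auto simp: I_lim_def)
    then show ?thesis using \<nu> nc False by (intro exI[of _ "\<lambda>_. \<nu>"]) (simp add: I_lim_def)
  qed
  ultimately show ?thesis by blast
qed

end
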